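(* Let $p$ be a prime, $1\le r\le q<\infty$, $0\le\beta<1$, $\lambda\ge0$, and suppose $\frac{\lambda}{2}+1>\beta+\frac1q$. Then the operator $$\mathscr{D}^p_\lambda f(s)=\int_{\mathbb{Q}_p^*}\frac{(|s|_p|t|_p)^{\lambda/2}}{\max\{|s|_p,|t|_p\}^{\lambda+1}}\,f(t)\,dt,\qquad s\in\mathbb{Q}_p^*,$$ is bounded on $C^{\beta}M_{r,q}(\mathbb{Q}_p)$, i.e. there is a constant $C>0$ such that $\|\mathscr{D}^p_\lambda f\|_{C^{\beta}M_{r,q}(\mathbb{Q}_p)}\le C\|f\|_{C^{\beta}M_{r,q}(\mathbb{Q}_p)}$ for all $f\in C^{\beta}M_{r,q}(\mathbb{Q}_p)$.
   Context: $\mathbb{Q}_p$ is the field of $p$-adic numbers with the $p$-adic absolute value $|\cdot|_p$, $\mathbb{Q}_p^*=\mathbb{Q}_p\setminus\{0\}$, and $dx$ is the Haar measure on $(\mathbb{Q}_p,+)$ normalized so that $\{x:|x|_p\le 1\}$ has measure $1$; $|E|$ denotes the measure of $E$. For $a\in\mathbb{Q}_p$, $\ell\in\mathbb{Z}$, let $B^\ell(a)=\{x\in\mathbb{Q}_p:|x-a|_p\le p^\ell\}$, so $|B^\ell(a)|=p^\ell$. For $1\le r\le q<\infty$ and $0\le\beta<1$, the fractional Cesàro–Morrey space $C^{\beta}M_{r,q}(\mathbb{Q}_p)$ consists of all locally integrable functions $f$ on $\mathbb{Q}_p$ with $\|f\|_{C^{\beta}M_{r,q}(\mathbb{Q}_p)}<\infty$,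 where for measurable $f$ (with values in $[0,\infty]$) $$\|f\|_{C^{\beta}M_{r,q}(\mathbb{Q}_p)}=\sup_{a\in\mathbb{Q}_p,\ \ell\in\mathbb{Z}}|B^\ell(a)|^{\frac1q-\frac1r}\left(\int_{B^\ell(a)}\left(\frac{1}{|x|_p^{1-\beta}}\int_{|t|_p\le|x|_p}|f(t)|\,dt\right)^r dx\right)^{1/r}.$$ *)

theory Defs
  imports
    "HOL-Analysis.Analysis"
    "HOL-Computational_Algebra.Primes"
begin

section \<open>The \<open>p\<close>-adic absolute value on the rationals\<close>

definition padic_abs :: "nat \<Rightarrow> rat \<Rightarrow> real" where
  "padic_abs p x =
     (if x = 0 then 0
      else real p powi (int (multiplicity (int p) (snd (quotient_of x)))
                      - int (multiplicity (int p) (fst (quotient_of x)))))"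

lemma padic_abs_0 [simp]: "padic_abs p 0 = 0"
  by (simp add: padic_abs_def)

lemma padic_abs_fract:
  assumes p: "prime p" and a: "a \<noteq> 0" and b: "b \<noteq> 0"
  shows "padic_abs p (of_int a / of_int b)
           = real p powi (int (multiplicity (int p) b) - int (multiplicity (int p) a))"
proof -
  let ?x = "of_int a / of_int b :: rat"
  have pe: "prime_elem (int p)" using p by simp
  obtain c d where q: "quotient_of ?x = (c, d)" by fastforce
  have d: "d \<noteq> 0" using quotient_of_denom_pos[OF q] by simp
  have x: "?x = of_int c / of_int d" using quotient_of_div[OF q] .
  have "of_int a * of_int d = (of_int c * of_int b :: rat)"
    using x b d by (simp add: frac_eq_eq)
  hence eq: "a * d = c * b" by (metis of_int_eq_iff of_int_mult)
  have c: "c \<noteq> 0" using eq a d by auto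
  have "multiplicity (int p) a + multiplicity (int p) d
      = multiplicity (int p) c + multiplicity (int p) b"
    using arg_cong[OF eq, of "multiplicity (int p)"] a b c d
    by (simp add: prime_elem_multiplicity_mult_distrib[OF pe])
  hence "int (multiplicity (int p) d) - int (multiplicity (int p) c)
       = int (multiplicity (int p) b) - int (multiplicity (int p) a)" by linarith
  thus ?thesis using a b q by (simp add: padic_abs_def)
qed

lemma rat_fractE:
  fixes x :: rat
  obtains a b where "x = of_int a / of_int b" "b \<noteq> 0"
  by (metis quotient_of_div quotient_of_denom_pos less_irrefl surj_pair)

lemma padic_abs_nonneg [simp]: "0 \<le> padic_abs p x"
  by (simp add: padic_abs_def)

lemma padic_abs_eq_0_iff:
  assumes "prime p" shows "padic_abs p x = 0 \<longleftrightarrow> x = 0"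
  using prime_gt_0_nat[OF assms] by (simp add: padic_abs_def)

lemma padic_abs_1: "prime p \<Longrightarrow> padic_abs p 1 = 1"
  using padic_abs_fract[of p 1 1] by simp

lemma padic_abs_mult:
  assumes p: "prime p" shows "padic_abs p (x * y) = padic_abs p x * padic_abs p y"
proof (cases "x = 0 \<or> y = 0")
  case False
  obtain a b where x: "x = of_int a / of_int b" "b \<noteq> 0" by (rule rat_fractE)
  obtain c d where y: "y = of_int c / of_int d" "d \<noteq> 0" by (rule rat_fractE)
  have nz: "a \<noteq> 0" "c \<noteq> 0" using False x y by auto
  have xy: "x * y = of_int (a * c) / of_int (b * d)" by (simp add: x y)
  have pe: "prime_elem (int p)" and p0: "real p \<noteq> 0" using p prime_gt_0_nat[OF p] by auto
  show ?thesis
    using x(2) y(2) nz p0 unfolding xy unfolding x(1) y(1)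
    by (subst (1 2 3) padic_abs_fract[OF p])
       (simp_all add: prime_elem_multiplicity_mult_distrib[OF pe] power_int_diff power_int_add)
qed auto

lemma padic_abs_minus [simp]: "padic_abs p (- x) = padic_abs p x"
proof -
  have "multiplicity (int p) (- a) = multiplicity (int p) a" for a
    using multiplicity_times_unit_right[of "-1" "int p" a] by simp
  thus ?thesis by (simp add: padic_abs_def rat_uminus_code case_prod_beta Let_def)
qed

lemma padic_abs_minus_commute: "padic_abs p (x - y) = padic_abs p (y - x)"
  using padic_abs_minus[of p "y - x"] by simp

lemma padic_abs_add_le_max:
  assumes p: "prime p"
  shows "padic_abs p (x + y) \<le> max (padic_abs p x) (padic_abs p y)"
proof (cases "x = 0 \<or> y = 0 \<or> x + y = 0")
  case False
  obtain a0 b0 where x0: "x = of_int a0 / of_int b0" "b0 \<noteq> 0" by (rule rat_fractE)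
  obtain c0 d0 where y0: "y = of_int c0 / of_int d0" "d0 \<noteq> 0" by (rule rat_fractE)
  define a b c where "a = a0 * d0" and "b = b0 * d0" and "c = c0 * b0"
  have b: "b \<noteq> 0" using x0 y0 by (simp add: b_def)
  have x: "x = of_int a / of_int b" and y: "y = of_int c / of_int b"
    using x0 y0 by (simp_all add: a_def b_def c_def)
  have xy: "x + y = of_int (a + c) / of_int b" by (simp add: x y add_divide_distrib)
  have nz: "a \<noteq> 0" "c \<noteq> 0" "a + c \<noteq> 0"
  proof -
    have "x \<noteq> 0" "y \<noteq> 0" "x + y \<noteq> 0" using False by auto
    thus "a \<noteq> 0" "c \<noteq> 0" "a + c \<noteq> 0" unfolding xy unfolding x y by force+
  qed
  let ?v = "multiplicity (int p)"
  have p1: "1 \<le> real p" using prime_gt_0_nat[OF p] by linarith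
  have "\<not> is_unit (int p)" using p by (simp add: prime_nat_iff)
  hence v: "min (?v a) (?v c) \<le> ?v (a + c)"
    using nz by (intro multiplicity_geI dvd_add) (auto intro: multiplicity_dvd')
  have "?v a \<le> ?v (a + c) \<or> ?v c \<le> ?v (a + c)" using v by linarith
  hence "padic_abs p (x + y) \<le> padic_abs p x \<or> padic_abs p (x + y) \<le> padic_abs p y"
    unfolding xy unfolding x y padic_abs_fract[OF p nz(1) b] padic_abs_fract[OF p nz(2) b]
      padic_abs_fract[OF p nz(3) b]
    using p1 by (auto intro!: power_int_increasing)
  thus ?thesis by linarith
qed (auto simp: le_max_iff_disj)

lemma padic_abs_triangle:
  assumes p: "prime p" shows "padic_abs p (x + y) \<le> padic_abs p x + padic_abs p y"
  using padic_abs_add_le_max[OF p, of x y] padic_abs_nonneg[of p x] padic_abs_nonneg[of p y]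
  by linarith

lemma padic_abs_diff_le:
  assumes p: "prime p" shows "\<bar>padic_abs p x - padic_abs p y\<bar> \<le> padic_abs p (x - y)"
  using padic_abs_triangle[OF p, of "x - y" y] padic_abs_triangle[OF p, of "y - x" x]
    padic_abs_minus_commute[of p x y] by simp


section \<open>The field of \<open>p\<close>-adic numbers as the completion of the rationals\<close>

definition padic_cauchy :: "nat \<Rightarrow> (nat \<Rightarrow> rat) \<Rightarrow> bool" where
  "padic_cauchy p X \<longleftrightarrow> (\<forall>e>0. \<exists>N. \<forall>m\<ge>N. \<forall>n\<ge>N. padic_abs p (X m - X n) < e)"

definition padic_null :: "nat \<Rightarrow> (nat \<Rightarrow> rat) \<Rightarrow> bool" where
  "padic_null p X \<longleftrightarrow> (\<lambda>n. padic_abs p (X n)) \<longlonglongrightarrow> 0"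

definition padic_rel :: "nat \<Rightarrow> (nat \<Rightarrow> rat) \<Rightarrow> (nat \<Rightarrow> rat) \<Rightarrow> bool" where
  "padic_rel p X Y \<longleftrightarrow> padic_cauchy p X \<and> padic_cauchy p Y \<and> padic_null p (\<lambda>n. X n - Y n)"

lemma padic_cauchy_const [simp]: "padic_cauchy p (\<lambda>_. c)"
  by (simp add: padic_cauchy_def)

lemma padic_cauchy_dominated:
  assumes "padic_cauchy p X" "padic_cauchy p Y" "0 \<le> K"
    and le: "\<And>m n. padic_abs p (Z m - Z n)
                 \<le> K * (padic_abs p (X m - X n) + padic_abs p (Y m - Y n))"
  shows "padic_cauchy p Z"
  unfolding padic_cauchy_def
proof (intro allI impI)
  fix e :: real assume e: "0 < e"
  define d where "d = e / (2 * (K + 1))"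
  have d: "0 < d" using e assms(3) by (simp add: d_def)
  obtain M where M: "\<forall>m\<ge>M. \<forall>n\<ge>M. padic_abs p (X m - X n) < d"
    using assms(1) d unfolding padic_cauchy_def by blast
  obtain N where N: "\<forall>m\<ge>N. \<forall>n\<ge>N. padic_abs p (Y m - Y n) < d"
    using assms(2) d unfolding padic_cauchy_def by blast
  have "padic_abs p (Z m - Z n) < e" if "m \<ge> max M N" "n \<ge> max M N" for m n
  proof -
    have "padic_abs p (X m - X n) + padic_abs p (Y m - Y n) \<le> 2 * d"
      using M N that by (smt (verit) max.bounded_iff)
    hence "padic_abs p (Z m - Z n) \<le> K * (2 * d)"
      using le[of m n] assms(3) by (meson mult_left_mono order_trans)
    also have "\<dots> < (K + 1) * (2 * d)" using d by simp
    also have "\<dots> = e"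
      using d by (simp only: d_def) (simp add: zero_less_divide_iff divide_simps split: if_splits)
    finally show ?thesis .
  qed
  thus "\<exists>N. \<forall>m\<ge>N. \<forall>n\<ge>N. padic_abs p (Z m - Z n) < e" by blast
qed

lemma padic_cauchy_add:
  assumes p: "prime p" and X: "padic_cauchy p X" and Y: "padic_cauchy p Y"
  shows "padic_cauchy p (\<lambda>n. X n + Y n)"
proof (rule padic_cauchy_dominated[OF X Y, of 1])
  fix m n
  have "X m + Y m - (X n + Y n) = (X m - X n) + (Y m - Y n)" by simp
  thus "padic_abs p (X m + Y m - (X n + Y n))
      \<le> 1 * (padic_abs p (X m - X n) + padic_abs p (Y m - Y n))"
    using padic_abs_triangle[OF p] by (metis mult_1)
qed simp

lemma padic_cauchy_uminus:
  assumes X: "padic_cauchy p X"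
  shows "padic_cauchy p (\<lambda>n. - X n)"
proof -
  have "- X m - - X n = - (X m - X n)" for m n by simp
  hence "padic_abs p (- X m - - X n) = padic_abs p (X m - X n)" for m n
    by (metis padic_abs_minus)
  thus ?thesis using X by (simp add: padic_cauchy_def)
qed

lemma padic_cauchy_diff:
  assumes "prime p" "padic_cauchy p X" "padic_cauchy p Y"
  shows "padic_cauchy p (\<lambda>n. X n - Y n)"
  using padic_cauchy_add[OF assms(1,2) padic_cauchy_uminus[OF assms(3)]] by simp

lemma padic_cauchy_convergent:
  assumes p: "prime p" and X: "padic_cauchy p X"
  shows "convergent (\<lambda>n. padic_abs p (X n))"
proof -
  have "Cauchy (\<lambda>n. padic_abs p (X n))"
  proof (rule metric_CauchyI)
    fix e :: real assume "0 < e"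
    then obtain N where "\<forall>m\<ge>N. \<forall>n\<ge>N. padic_abs p (X m - X n) < e"
      using X unfolding padic_cauchy_def by blast
    thus "\<exists>M. \<forall>m\<ge>M. \<forall>n\<ge>M. dist (padic_abs p (X m)) (padic_abs p (X n)) < e"
      using padic_abs_diff_le[OF p] unfolding dist_real_def by (meson le_less_trans)
  qed
  thus ?thesis by (simp add: Cauchy_convergent_iff)
qed

lemma padic_cauchy_bounded:
  assumes p: "prime p" and X: "padic_cauchy p X"
  shows "\<exists>B\<ge>0. \<forall>n. padic_abs p (X n) \<le> B"
proof -
  have "Bseq (\<lambda>n. padic_abs p (X n))"
    by (rule convergent_imp_Bseq[OF padic_cauchy_convergent[OF p X]])
  then obtain B where "0 < B" "\<forall>n. norm (padic_abs p (X n)) \<le> B" by (rule BseqE)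
  thus ?thesis by (intro exI[of _ B]) auto
qed

lemma padic_abs_mult_diff_le:
  assumes p: "prime p"
    and "padic_abs p a \<le> K" "padic_abs p d \<le> K"
  shows "padic_abs p (a * b - c * d) \<le> K * (padic_abs p (a - c) + padic_abs p (b - d))"
proof -
  have "a * b - c * d = (a - c) * d + a * (b - d)" by (simp add: algebra_simps)
  hence "padic_abs p (a * b - c * d)
      \<le> padic_abs p (a - c) * padic_abs p d + padic_abs p a * padic_abs p (b - d)"
    by (metis padic_abs_triangle[OF p] padic_abs_mult[OF p])
  also have "\<dots> \<le> padic_abs p (a - c) * K + K * padic_abs p (b - d)"
    using assms by (intro add_mono mult_mono) (auto intro: order_trans[OF padic_abs_nonneg])
  finally show ?thesis by (simp add: algebra_simps)
qed

lemma padic_cauchy_mult: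
  assumes p: "prime p" and X: "padic_cauchy p X" and Y: "padic_cauchy p Y"
  shows "padic_cauchy p (\<lambda>n. X n * Y n)"
proof -
  obtain A where A: "0 \<le> A" "\<And>n. padic_abs p (X n) \<le> A" using padic_cauchy_bounded[OF p X] by blast
  obtain B where B: "0 \<le> B" "\<And>n. padic_abs p (Y n) \<le> B" using padic_cauchy_bounded[OF p Y] by blast
  show ?thesis
    using A B
    by (intro padic_cauchy_dominated[OF X Y, of "max A B"] padic_abs_mult_diff_le[OF p])
       (auto simp: le_max_iff_disj)
qed

lemma padic_null_dominated:
  assumes "padic_null p X" "padic_null p Y"
    and le: "\<And>n. padic_abs p (Z n) \<le> K * (padic_abs p (X n) + padic_abs p (Y n))"
  shows "padic_null p Z"
proof -
  have "(\<lambda>n. K * (padic_abs p (X n) + padic_abs p (Y n))) \<longlonglongrightarrow> K * (0 + 0)"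
    using assms(1,2) unfolding padic_null_def by (intro tendsto_intros)
  hence "(\<lambda>n. K * (padic_abs p (X n) + padic_abs p (Y n))) \<longlonglongrightarrow> 0" by simp
  thus ?thesis
    unfolding padic_null_def
    by (rule Lim_null_comparison[rotated]) (use le in simp)
qed

lemma padic_null_const_iff: "prime p \<Longrightarrow> padic_null p (\<lambda>_. c) \<longleftrightarrow> c = 0"
  by (simp add: padic_null_def LIMSEQ_const_iff padic_abs_eq_0_iff)

lemma padic_null_add:
  assumes p: "prime p" and "padic_null p X" "padic_null p Y"
  shows "padic_null p (\<lambda>n. X n + Y n)"
  by (rule padic_null_dominated[OF assms(2,3), of _ 1]) (simp add: padic_abs_triangle[OF p])

lemma padic_null_uminus_iff [simp]: "padic_null p (\<lambda>n. - X n) \<longleftrightarrow> padic_null p X"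
  by (simp add: padic_null_def)

lemma padic_not_null_bound:
  assumes p: "prime p" and X: "padic_cauchy p X" and nn: "\<not> padic_null p X"
  obtains c N where "0 < c" "\<And>n. n \<ge> N \<Longrightarrow> c \<le> padic_abs p (X n)"
proof -
  obtain L where L: "(\<lambda>n. padic_abs p (X n)) \<longlonglongrightarrow> L"
    using padic_cauchy_convergent[OF p X] unfolding convergent_def by blast
  have "0 \<le> L" by (rule LIMSEQ_le_const[OF L]) auto
  moreover have "L \<noteq> 0" using nn L by (auto simp: padic_null_def)
  ultimately have "0 < L / 2" "L / 2 < L" by auto
  with order_tendstoD(1)[OF L] show ?thesis
    using that[of "L / 2"] unfolding eventually_sequentially by (meson less_imp_le)
qed

lemma padic_rel_refl: "padic_cauchy p X \<Longrightarrow> padic_rel p X X"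
  by (simp add: padic_rel_def padic_null_def)

lemma padic_rel_sym: "padic_rel p X Y \<Longrightarrow> padic_rel p Y X"
  unfolding padic_rel_def padic_null_def by (simp add: padic_abs_minus_commute)

lemma padic_rel_trans:
  assumes p: "prime p" and "padic_rel p X Y" "padic_rel p Y Z"
  shows "padic_rel p X Z"
  using padic_null_add[OF p, of "\<lambda>n. X n - Y n" "\<lambda>n. Y n - Z n"] assms
  by (auto simp: padic_rel_def)

lemma part_equivp_padic_rel:
  assumes "prime p" shows "part_equivp (padic_rel p)"
proof (rule part_equivpI)
  show "\<exists>X. padic_rel p X X" using padic_rel_refl[OF padic_cauchy_const] by blast
qed (auto simp: symp_def transp_def intro: padic_rel_sym padic_rel_trans[OF assms])

lemma padic_rel_add:
  assumes p: "prime p" and "padic_rel p X X'" "padic_rel p Y Y'"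
  shows "padic_rel p (\<lambda>n. X n + Y n) (\<lambda>n. X' n + Y' n)"
  using assms padic_null_add[OF p, of "\<lambda>n. X n - X' n" "\<lambda>n. Y n - Y' n"]
  by (auto simp: padic_rel_def algebra_simps intro: padic_cauchy_add)

lemma padic_rel_uminus:
  assumes "padic_rel p X X'"
  shows "padic_rel p (\<lambda>n. - X n) (\<lambda>n. - X' n)"
proof -
  have "padic_null p (\<lambda>n. - (X n - X' n))"
    using assms unfolding padic_null_uminus_iff padic_rel_def by blast
  thus ?thesis using assms by (auto simp: padic_rel_def intro: padic_cauchy_uminus)
qed

lemma padic_rel_mult:
  assumes p: "prime p" and XX: "padic_rel p X X'" and YY: "padic_rel p Y Y'"
  shows "padic_rel p (\<lambda>n. X n * Y n) (\<lambda>n. X' n * Y' n)"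
proof -
  have c: "padic_cauchy p X" "padic_cauchy p X'" "padic_cauchy p Y" "padic_cauchy p Y'"
    and n: "padic_null p (\<lambda>n. X n - X' n)" "padic_null p (\<lambda>n. Y n - Y' n)"
    using XX YY by (auto simp: padic_rel_def)
  obtain A where A: "0 \<le> A" "\<And>n. padic_abs p (X n) \<le> A"
    using padic_cauchy_bounded[OF p c(1)] by blast
  obtain B where B: "0 \<le> B" "\<And>n. padic_abs p (Y' n) \<le> B"
    using padic_cauchy_bounded[OF p c(4)] by blast
  have "padic_null p (\<lambda>n. X n * Y n - X' n * Y' n)"
    using A B
    by (intro padic_null_dominated[OF n, of _ "max A B"] padic_abs_mult_diff_le[OF p])
       (auto simp: le_max_iff_disj)
  thus ?thesis using c p by (auto simp: padic_rel_def intro: padic_cauchy_mult)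
qed

lemma padic_rel_null_iff:
  assumes p: "prime p" and XX: "padic_rel p X X'"
  shows "padic_null p X \<longleftrightarrow> padic_null p X'"
proof -
  have "padic_null p Z'" if "padic_null p Z" "padic_rel p Z Z'" for Z Z'
  proof -
    have "padic_null p (\<lambda>n. - (Z n - Z' n))"
      using that(2) unfolding padic_null_uminus_iff padic_rel_def by blast
    from padic_null_add[OF p that(1) this] show ?thesis by simp
  qed
  thus ?thesis using XX padic_rel_sym by blast
qed

lemma padic_rel_inverse:
  assumes p: "prime p" and XX: "padic_rel p X X'"
  shows "padic_rel p (if padic_null p X then (\<lambda>n. 0) else (\<lambda>n. inverse (X n)))
                     (if padic_null p X' then (\<lambda>n. 0) else (\<lambda>n. inverse (X' n)))"
proof (cases "padic_null p X")
  case True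
  thus ?thesis using padic_rel_null_iff[OF p XX] padic_rel_refl by simp
next
  case False
  have c: "padic_cauchy p X" "padic_cauchy p X'" and n: "padic_null p (\<lambda>n. X n - X' n)"
    and nX': "\<not> padic_null p X'"
    using XX False padic_rel_null_iff[OF p XX] by (auto simp: padic_rel_def)
  have inv: "padic_abs p (inverse a - inverse b) \<le> padic_abs p (a - b) / (k * l)"
    if kl: "0 < k" "0 < l" "k \<le> padic_abs p a" "l \<le> padic_abs p b" for a b k l
  proof -
    have nz: "a \<noteq> 0" "b \<noteq> 0" using kl by auto
    have "(inverse a - inverse b) * (a * b) = b - a" using nz by (simp add: field_simps)
    hence "padic_abs p (inverse a - inverse b) * (padic_abs p a * padic_abs p b)
         = padic_abs p (a - b)"
      by (metis padic_abs_mult[OF p] padic_abs_minus_commute)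
    moreover have "k * l \<le> padic_abs p a * padic_abs p b"
      using kl by (intro mult_mono) auto
    ultimately have "padic_abs p (inverse a - inverse b) * (k * l) \<le> padic_abs p (a - b)"
      by (metis mult_left_mono padic_abs_nonneg)
    thus ?thesis using kl by (simp add: pos_le_divide_eq)
  qed
  have cinv: "padic_cauchy p (\<lambda>n. inverse (Z n))"
    if Z: "padic_cauchy p Z" "\<not> padic_null p Z" for Z
    unfolding padic_cauchy_def
  proof (intro allI impI)
    fix e :: real assume e: "0 < e"
    obtain k N where k: "0 < k" "\<And>n. n \<ge> N \<Longrightarrow> k \<le> padic_abs p (Z n)"
      using padic_not_null_bound[OF p Z] by blast
    have "0 < e * (k * k)" using e k by simp
    then obtain M where M: "\<forall>m\<ge>M. \<forall>n\<ge>M. padic_abs p (Z m - Z n) < e * (k * k)"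
      using Z(1) unfolding padic_cauchy_def by blast
    have "padic_abs p (inverse (Z m) - inverse (Z n)) < e"
      if "m \<ge> max M N" "n \<ge> max M N" for m n
    proof -
      have "padic_abs p (inverse (Z m) - inverse (Z n)) \<le> padic_abs p (Z m - Z n) / (k * k)"
        using inv k that by simp
      also have "\<dots> < e" using M that k by (simp add: pos_divide_less_eq)
      finally show ?thesis .
    qed
    thus "\<exists>N. \<forall>m\<ge>N. \<forall>n\<ge>N. padic_abs p (inverse (Z m) - inverse (Z n)) < e" by blast
  qed
  obtain k N where k: "0 < k" "\<And>n. n \<ge> N \<Longrightarrow> k \<le> padic_abs p (X n)"
    using padic_not_null_bound[OF p c(1) False] by blast
  obtain l M where l: "0 < l" "\<And>n. n \<ge> M \<Longrightarrow> l \<le> padic_abs p (X' n)"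
    using padic_not_null_bound[OF p c(2) nX'] by blast
  have "(\<lambda>n. padic_abs p (X n - X' n) / (k * l)) \<longlonglongrightarrow> 0"
    using n unfolding padic_null_def by (rule tendsto_divide_zero)
  moreover have "\<forall>\<^sub>F n in sequentially.
      norm (padic_abs p (inverse (X n) - inverse (X' n))) \<le> padic_abs p (X n - X' n) / (k * l)"
    using inv k l unfolding eventually_sequentially by (intro exI[of _ "max M N"]) auto
  ultimately have "padic_null p (\<lambda>n. inverse (X n) - inverse (X' n))"
    unfolding padic_null_def
    by (rule Lim_null_comparison[rotated])
  thus ?thesis using False nX' cinv c by (simp add: padic_rel_def)
qed

lemma padic_rel_lim:
  assumes p: "prime p" and XX: "padic_rel p X X'"
  shows "lim (\<lambda>n. padic_abs p (X n)) = lim (\<lambda>n. padic_abs p (X' n))"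
proof -
  obtain L where L: "(\<lambda>n. padic_abs p (X n)) \<longlonglongrightarrow> L"
    using padic_cauchy_convergent[OF p] XX unfolding convergent_def padic_rel_def by blast
  have "(\<lambda>n. padic_abs p (X' n) - padic_abs p (X n)) \<longlonglongrightarrow> 0"
    using XX unfolding padic_rel_def padic_null_def
    by (intro Lim_null_comparison[of "\<lambda>n. padic_abs p (X' n) - padic_abs p (X n)"
          "\<lambda>n. padic_abs p (X n - X' n)"])
       (auto simp: padic_abs_minus_commute[of p "X _"] padic_abs_diff_le[OF p])
  from tendsto_add[OF this L] have "(\<lambda>n. padic_abs p (X' n)) \<longlonglongrightarrow> L" by simp
  with L show ?thesis by (simp add: limI)
qed

class prime_card =
  assumes prime_card: "prime CARD('a)"

text \<open>The prime is \<open>p = CARD('a)\<close>. The elements are classes of \<open>p\<close>-adic Cauchy sequences of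
  rationals modulo null sequences.\<close>

typedef (overloaded) ('a :: prime_card) padic =
    "{c. \<exists>X. padic_rel CARD('a) X X \<and> c = Collect (padic_rel CARD('a) X)}"
  using padic_rel_refl[OF padic_cauchy_const] by blast

definition abs_padic :: "(nat \<Rightarrow> rat) \<Rightarrow> 'a :: prime_card padic" where
  "abs_padic X = Abs_padic (Collect (padic_rel CARD('a) X))"

definition rep_padic :: "'a :: prime_card padic \<Rightarrow> nat \<Rightarrow> rat" where
  "rep_padic x = (SOME X. X \<in> Rep_padic x)"

definition cr_padic :: "(nat \<Rightarrow> rat) \<Rightarrow> 'a :: prime_card padic \<Rightarrow> bool" where
  "cr_padic = (\<lambda>X x. padic_rel CARD('a) X X \<and> abs_padic X = x)"

lemma Quotient_padic:
  "Quotient (padic_rel CARD('a)) abs_padic (rep_padic :: 'a :: prime_card padic \<Rightarrow> _) cr_padic"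
proof -
  interpret quot_type "padic_rel CARD('a)" "Abs_padic :: _ \<Rightarrow> 'a padic" Rep_padic
  proof
    show "part_equivp (padic_rel CARD('a))" by (rule part_equivp_padic_rel[OF prime_card])
    show "\<And>y :: 'a padic. \<exists>X. padic_rel CARD('a) X X \<and> Rep_padic y = Collect (padic_rel CARD('a) X)"
      using Rep_padic by blast
    show "\<And>x :: 'a padic. Abs_padic (Rep_padic x) = x" by (rule Rep_padic_inverse)
    show "\<And>c. \<exists>X. padic_rel CARD('a) X X \<and> c = Collect (padic_rel CARD('a) X) \<Longrightarrow>
        Rep_padic (Abs_padic c :: 'a padic) = c"
      by (rule Abs_padic_inverse) simp
    show "\<And>x y :: 'a padic. (Rep_padic x = Rep_padic y) = (x = y)" by (rule Rep_padic_inject)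
  qed
  have "abs = (abs_padic :: _ \<Rightarrow> 'a padic)" "rep = (rep_padic :: 'a padic \<Rightarrow> _)"
    by (auto simp: fun_eq_iff abs_def abs_padic_def rep_def rep_padic_def)
  with Quotient have "Quotient3 (padic_rel CARD('a)) abs_padic (rep_padic :: 'a padic \<Rightarrow> _)" by simp
  thus ?thesis by (rule Quotient3_to_Quotient) (simp add: cr_padic_def)
qed

setup_lifting Quotient_padic

instantiation padic :: (prime_card) field
begin

lift_definition zero_padic :: "'a padic" is "\<lambda>n. 0"
  by (rule padic_rel_refl) simp

lift_definition one_padic :: "'a padic" is "\<lambda>n. 1"
  by (rule padic_rel_refl) simp

lift_definition plus_padic :: "'a padic \<Rightarrow> 'a padic \<Rightarrow> 'a padic" is "\<lambda>X Y n. X n + Y n"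
  by (rule padic_rel_add[OF prime_card])

lift_definition uminus_padic :: "'a padic \<Rightarrow> 'a padic" is "\<lambda>X n. - X n"
  by (rule padic_rel_uminus)

lift_definition times_padic :: "'a padic \<Rightarrow> 'a padic \<Rightarrow> 'a padic" is "\<lambda>X Y n. X n * Y n"
  by (rule padic_rel_mult[OF prime_card])

lift_definition inverse_padic :: "'a padic \<Rightarrow> 'a padic"
  is "\<lambda>X. if padic_null CARD('a) X then (\<lambda>n. 0) else (\<lambda>n. inverse (X n))"
  by (rule padic_rel_inverse[OF prime_card])

definition minus_padic :: "'a padic \<Rightarrow> 'a padic \<Rightarrow> 'a padic" where
  "minus_padic x y = x + - y"

definition divide_padic :: "'a padic \<Rightarrow> 'a padic \<Rightarrow> 'a padic" where
  "divide_padic x y = x * inverse y"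

instance
proof
  fix a b c :: "'a padic"
  note pr = prime_card[where 'a = 'a]
  note cl = padic_rel_def padic_cauchy_add[OF pr] padic_cauchy_mult[OF pr] padic_cauchy_uminus
  show "a + b + c = a + (b + c)"
    by transfer (auto simp: cl padic_null_const_iff[OF pr] algebra_simps)
  show "a + b = b + a"
    by transfer (auto simp: cl padic_null_const_iff[OF pr])
  show "0 + a = a"
    by transfer (auto simp: cl padic_null_const_iff[OF pr])
  show "- a + a = 0"
    by transfer (auto simp: cl padic_null_const_iff[OF pr])
  show "a - b = a + - b"
    by (simp add: minus_padic_def)
  show "a * b * c = a * (b * c)"
    by transfer (auto simp: cl padic_null_const_iff[OF pr])
  show "a * b = b * a"
    by transfer (auto simp: cl padic_null_const_iff[OF pr] mult.commute)
  show "1 * a = a"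
    by transfer (auto simp: cl padic_null_const_iff[OF pr])
  show "(a + b) * c = a * c + b * c"
    by transfer (auto simp: cl padic_null_const_iff[OF pr] algebra_simps)
  show "(0 :: 'a padic) \<noteq> 1"
    by transfer (auto simp: cl padic_null_def padic_abs_1[OF pr] LIMSEQ_const_iff)
  show "inverse (0 :: 'a padic) = 0"
    by transfer (auto simp: cl padic_null_const_iff[OF pr])
  show "a div b = a * inverse b"
    by (simp add: divide_padic_def)
  show "inverse a * a = 1" if "a \<noteq> 0"
    using that
  proof transfer
    fix X :: "nat \<Rightarrow> rat"
    assume XX: "padic_rel CARD('a) X X" and "\<not> padic_rel CARD('a) X (\<lambda>n. 0)"
    hence c: "padic_cauchy CARD('a) X" and nn: "\<not> padic_null CARD('a) X"
      by (auto simp: padic_rel_def)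
    have ci: "padic_cauchy CARD('a) (\<lambda>n. inverse (X n))"
      using padic_rel_inverse[OF pr XX] nn by (simp add: padic_rel_def)
    obtain k N where k: "0 < k" "\<And>n. n \<ge> N \<Longrightarrow> k \<le> padic_abs CARD('a) (X n)"
      using padic_not_null_bound[OF pr c nn] by blast
    have nz: "X n \<noteq> 0" if "n \<ge> N" for n
    proof
      assume "X n = 0"
      thus False using k(2)[OF that] k(1) by simp
    qed
    have "\<forall>\<^sub>F n in sequentially. padic_abs CARD('a) (inverse (X n) * X n - 1) = 0"
      unfolding eventually_sequentially using nz by (intro exI[of _ N]) simp
    hence "padic_null CARD('a) (\<lambda>n. inverse (X n) * X n - 1)"
      unfolding padic_null_def by (rule tendsto_eventually)
    thus "padic_rel CARD('a)
        (\<lambda>n. (if padic_null CARD('a) X then \<lambda>n. 0 else (\<lambda>n. inverse (X n))) n * X n) (\<lambda>n. 1)"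
      using nn ci c by (simp add: cl)
  qed
qed

end

text \<open>The continuous extension of \<^const>\<open>padic_abs\<close>. The constant \<^const>\<open>norm\<close> is not used, as it
  is restricted to real normed vector spaces.\<close>

lift_definition padic_norm :: "'a :: prime_card padic \<Rightarrow> real"
  is "\<lambda>X. lim (\<lambda>n. padic_abs CARD('a) (X n))"
  by (rule padic_rel_lim[OF prime_card])

lemma padic_norm_eq_0_iff: "padic_norm x = 0 \<longleftrightarrow> x = 0" for x :: "'a :: prime_card padic"
proof transfer
  fix X :: "nat \<Rightarrow> rat"
  assume "padic_rel CARD('a) X X"
  hence c: "padic_cauchy CARD('a) X" by (simp add: padic_rel_def)
  have "(\<lambda>n. padic_abs CARD('a) (X n)) \<longlonglongrightarrow> lim (\<lambda>n. padic_abs CARD('a) (X n))"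
    using padic_cauchy_convergent[OF prime_card c] by (simp add: convergent_LIMSEQ_iff)
  hence "lim (\<lambda>n. padic_abs CARD('a) (X n)) = 0 \<longleftrightarrow> padic_null CARD('a) X"
    unfolding padic_null_def by (metis limI)
  thus "lim (\<lambda>n. padic_abs CARD('a) (X n)) = 0 \<longleftrightarrow> padic_rel CARD('a) X (\<lambda>n. 0)"
    using c by (simp add: padic_rel_def)
qed

lemma padic_norm_add_le_max: "padic_norm (x + y) \<le> max (padic_norm x) (padic_norm y)"
  for x y :: "'a :: prime_card padic"
proof transfer
  fix X Y :: "nat \<Rightarrow> rat"
  let ?a = "padic_abs CARD('a)"
  note pr = prime_card[where 'a = 'a]
  assume "padic_rel CARD('a) X X" "padic_rel CARD('a) Y Y"
  hence c: "padic_cauchy CARD('a) X" "padic_cauchy CARD('a) Y" by (auto simp: padic_rel_def)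
  have "(\<lambda>n. max (?a (X n)) (?a (Y n))) \<longlonglongrightarrow> max (lim (\<lambda>n. ?a (X n))) (lim (\<lambda>n. ?a (Y n)))"
    using padic_cauchy_convergent[OF pr] c
    by (intro tendsto_max) (auto simp: convergent_LIMSEQ_iff)
  moreover have "(\<lambda>n. ?a (X n + Y n)) \<longlonglongrightarrow> lim (\<lambda>n. ?a (X n + Y n))"
    using padic_cauchy_convergent[OF pr padic_cauchy_add[OF pr c]]
    by (simp add: convergent_LIMSEQ_iff)
  ultimately show "lim (\<lambda>n. ?a (X n + Y n)) \<le> max (lim (\<lambda>n. ?a (X n))) (lim (\<lambda>n. ?a (Y n)))"
    by (intro LIMSEQ_le) (auto simp: padic_abs_add_le_max[OF pr])
qed

lemma padic_norm_uminus: "padic_norm (- x) = padic_norm x" for x :: "'a :: prime_card padic"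
  by transfer (rule arg_cong[where f = lim], simp)

lemma padic_norm_nonneg: "0 \<le> padic_norm x" for x :: "'a :: prime_card padic"
  using padic_norm_add_le_max[of x "- x"] padic_norm_eq_0_iff[of "0 :: 'a padic"] by (simp add: padic_norm_uminus)

instantiation padic :: (prime_card) metric_space
begin

definition dist_padic :: "'a padic \<Rightarrow> 'a padic \<Rightarrow> real" where
  "dist_padic x y = padic_norm (x - y)"

definition uniformity_padic :: "('a padic \<times> 'a padic) filter" where
  "uniformity_padic = (INF e\<in>{0 <..}. principal {(x, y). dist x y < e})"

definition open_padic :: "'a padic set \<Rightarrow> bool" where
  "open_padic U \<longleftrightarrow> (\<forall>x\<in>U. \<forall>\<^sub>F (x', y) in uniformity. x' = x \<longrightarrow> y \<in> U)"

instance
proof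
  fix x y z :: "'a padic"
  show "uniformity = (INF e\<in>{0 <..}. principal {(x :: 'a padic, y). dist x y < e})"
    by (rule uniformity_padic_def)
  show "open U \<longleftrightarrow> (\<forall>x\<in>U. \<forall>\<^sub>F (x', y) in uniformity. x' = x \<longrightarrow> y \<in> U)" for U :: "'a padic set"
    by (rule open_padic_def)
  show "dist x y = 0 \<longleftrightarrow> x = y" by (simp add: dist_padic_def padic_norm_eq_0_iff)
  have "padic_norm (x - y) \<le> max (padic_norm (x - z)) (padic_norm (y - z))"
    using padic_norm_add_le_max[of "x - z" "- (y - z)"] padic_norm_uminus[of "y - z"] by simp
  thus "dist x y \<le> dist x z + dist y z"
    unfolding dist_padic_def
    using padic_norm_nonneg[of "x - z"] padic_norm_nonneg[of "y - z"] by linarith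
qed

end

lemma padic_norm_of_rat_seq:
  assumes "padic_cauchy CARD('p) X"
  shows "(\<lambda>n. padic_abs CARD('p) (X n)) \<longlonglongrightarrow> padic_norm (abs_padic X :: 'p :: prime_card padic)"
  using assms padic_cauchy_convergent[OF prime_card assms]
  by (simp add: padic_norm.abs_eq padic_rel_refl convergent_LIMSEQ_iff)


section \<open>Haar measure and balls\<close>

text \<open>Exactly one measure satisfies this, by existence and uniqueness of Haar measure: finiteness on
  compact sets follows from the normalization, and regularity is automatic since the space is Polish.\<close>

definition normalized_haar :: "'p :: prime_card padic measure \<Rightarrow> bool" where
  "normalized_haar M \<longleftrightarrow>
     sets M = sets borel \<and>
     (\<forall>a. \<forall>A\<in>sets borel. emeasure M ((+) a ` A) = emeasure M A) \<and>
     emeasure M {x. padic_norm x \<le> 1} = 1"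

definition padic_ball :: "'p :: prime_card padic \<Rightarrow> int \<Rightarrow> 'p padic set" where
  "padic_ball a l = {x. padic_norm (x - a) \<le> real CARD('p) powi l}"


section \<open>Fractional Cesaro--Morrey spaces\<close>

definition ennreal_powr :: "ennreal \<Rightarrow> real \<Rightarrow> ennreal" where
  "ennreal_powr x a = (if x = top then top else ennreal (enn2real x powr a))"
  \<comment> \<open>only meant for \<open>a > 0\<close>\<close>

text \<open>At the null point \<open>x = 0\<close> the weight \<open>1 / padic_norm x powr (1 - \<beta>)\<close> is \<open>0\<close> by convention.\<close>

definition cesaro_morrey_norm ::
    "'p :: prime_card padic measure \<Rightarrow> real \<Rightarrow> real \<Rightarrow> real \<Rightarrow> ('p padic \<Rightarrow> complex) \<Rightarrow> ennreal" where
  "cesaro_morrey_norm M \<beta> r q f =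
     (SUP a. SUP l.
        ennreal (measure M (padic_ball a l) powr (1 / q - 1 / r)) *
        ennreal_powr
          (\<integral>\<^sup>+x\<in>padic_ball a l.
             ennreal_powr
               (ennreal (1 / padic_norm x powr (1 - \<beta>)) *
                (\<integral>\<^sup>+t\<in>{t. padic_norm t \<le> padic_norm x}. ennreal (norm (f t)) \<partial>M)) r \<partial>M)
          (1 / r))"

definition locally_integrable :: "'p :: prime_card padic measure \<Rightarrow> ('p padic \<Rightarrow> complex) \<Rightarrow> bool" where
  "locally_integrable M f \<longleftrightarrow>
     f \<in> borel_measurable M \<and> (\<forall>K. compact K \<longrightarrow> set_integrable M K f)"

definition cesaro_morrey_space ::
    "'p :: prime_card padic measure \<Rightarrow> real \<Rightarrow> real \<Rightarrow> real \<Rightarrow> ('p padic \<Rightarrow> complex) set" where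
  "cesaro_morrey_space M \<beta> r q =
     {f. locally_integrable M f \<and> cesaro_morrey_norm M \<beta> r q f < top}"


section \<open>The operator\<close>

definition D_kernel :: "real \<Rightarrow> 'p :: prime_card padic \<Rightarrow> 'p padic \<Rightarrow> real" where
  "D_kernel lam s t =
     (padic_norm s * padic_norm t) powr (lam / 2) / max (padic_norm s) (padic_norm t) powr (lam + 1)"

text \<open>Only the values at \<open>s \<noteq> 0\<close> are meaningful; the point \<open>0\<close> is a null set.\<close>

definition D_operator ::
    "'p :: prime_card padic measure \<Rightarrow> real \<Rightarrow> ('p padic \<Rightarrow> complex) \<Rightarrow> 'p padic \<Rightarrow> complex" where
  "D_operator M lam f s = (LINT t:- {0}|M. of_real (D_kernel lam s t) * f t)"

end

theory Submission
  imports Defs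
begin

text \<open>
  Put \<open>P = CARD('p)\<close>. The inner integral of the norm and the kernel of the operator depend on
  \<open>padic_norm\<close> only, and the nonzero values of \<open>padic_norm\<close> are the powers of \<open>P\<close>, so the theorem is
  about sequences indexed by the integers. Write \<open>\<Phi> n\<close> for the integral of \<open>norm \<circ> f\<close> over
  the ball of radius \<open>P powr n\<close> about \<open>0\<close> and \<open>h n = P powr (n * (\<beta> - 1)) * \<Phi> n\<close> for the Cesaro
  mean.

  Up to constants, only balls about the origin matter in the norm: on a ball that misses the
  origin, \<open>padic_norm\<close> is constant, and its contribution is dominated by one term of a sum that
  belongs to a ball about the origin. As a sphere of radius \<open>P powr n\<close> has measure
  \<open>(1 - 1 / P) * P powr n\<close>, a bound on the norm by a multiple of \<open>N\<close> amounts to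
  the statement that, for every \<open>l\<close>, the sum of \<open>P powr n * h n powr r\<close> over \<open>n \<le> l\<close> is at most a constant times
  \<open>N powr r * P powr (l * (1 - r / q))\<close>
  (lemmas \<open>morrey_sum_le_of_cesaro_morrey_norm_le\<close> and
  \<open>cesaro_morrey_norm_le_of_morrey_sum_le\<close>).

  With \<open>k u = u powr (lam / 2) / max 1 u powr (lam + 1)\<close>, the kernel is
  \<open>k (\<bar>t\<bar> / \<bar>s\<bar>) / \<bar>s\<bar>\<close>; the operator is thus an average of dilations. Decomposing both
  integrals into spheres gives \<open>\<Phi>\<close> of the image at \<open>n\<close> at most the sum over \<open>i\<close> of
  \<open>k (P powr i) * \<Phi> (n + i)\<close> (lemma \<open>ball_mass_D_operator_le\<close>), hence the Cesaro mean of the image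
  is at most a convolution of \<open>h\<close> with the weights
  \<open>v i = k (P powr i) * P powr (i * (1 - \<beta>))\<close>. A shift by \<open>i\<close> multiplies the discrete Morrey norm by
  \<open>P powr (- i / q)\<close>, so Minkowski's inequality, here in the form of the weighted power mean
  inequality \<open>nn_integral_powr_mean_le\<close>, bounds the convolution with constant \<open>W\<close>, the sum of
  \<open>v i * P powr (- i / q)\<close> (lemma \<open>morrey_sum_convolution_le\<close>). This is a two-sided geometric
  sum: it converges at minus infinity because \<open>lam / 2 + 1 > \<beta> + 1 / q\<close>, and at plus infinity
  because \<open>lam / 2 + \<beta> + 1 / q > 0\<close>.
\<close>

section \<open>Powers on the extended half-line and the power mean inequality\<close>

lemma ennreal_powr_ennreal: "0 \<le> x \<Longrightarrow> ennreal_powr (ennreal x) a = ennreal (x powr a)"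
  by (simp add: ennreal_powr_def)

lemma ennreal_powr_top [simp]: "ennreal_powr top a = top"
  by (simp add: ennreal_powr_def)

lemma ennreal_powr_0 [simp]: "ennreal_powr 0 a = 0"
  by (simp add: ennreal_powr_def)

lemma ennreal_powr_mono:
  assumes "x \<le> y" "0 \<le> a" shows "ennreal_powr x a \<le> ennreal_powr y a"
  using assms
  by (cases x; cases y)
     (auto simp: ennreal_powr_ennreal top_unique intro!: ennreal_leI powr_mono2)

lemma ennreal_powr_cmult:
  assumes "0 < c" shows "ennreal_powr (ennreal c * y) a = ennreal (c powr a) * ennreal_powr y a"
  using assms
  by (cases y) (auto simp: ennreal_powr_ennreal ennreal_mult_top powr_mult
      ennreal_mult'[symmetric])

lemma ennreal_powr_le_iff:
  assumes "0 \<le> N" "0 < a" shows "ennreal_powr y (1 / a) \<le> ennreal N \<longleftrightarrow> y \<le> ennreal (N powr a)"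
proof (cases y)
  case (real u)
  have "u powr (1 / a) \<le> N \<longleftrightarrow> u \<le> N powr a"
    using assms real powr_mono2[of a "u powr (1 / a)" N] powr_mono2[of "1 / a" u "N powr a"]
    by (auto simp: powr_powr)
  thus ?thesis using real assms by (simp add: ennreal_powr_ennreal ennreal_le_iff)
qed (simp add: top_unique)

text \<open>The graph of the convex function \<open>y powr r\<close> lies above its tangent at \<open>c\<close>; the terms are arranged
so that no subtraction occurs and the inequality transfers to \<open>ennreal\<close>.\<close>

lemma powr_tangent_le:
  fixes y c r :: real
  assumes "1 \<le> r" "0 < c" "0 \<le> y"
  shows "r * c powr (r - 1) * y \<le> y powr r + (r - 1) * c powr r"
proof (cases "y = 0")
  case True
  thus ?thesis using assms by simp
next
  case False
  hence y: "0 < y" using assms by simp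
  have "y powr r - c powr r \<ge> (r * c powr (r - 1)) * (y - c)"
  proof (rule convex_on_imp_above_tangent[where A = "{0<..}"])
    show "((\<lambda>x. x powr r) has_field_derivative r * c powr (r - 1)) (at c within {0<..})"
      using assms by (auto intro!: derivative_eq_intros)
  qed (use assms y in \<open>auto intro!: powr_convex simp: interior_open\<close>)
  moreover have "r * c powr (r - 1) * (y - c) = r * c powr (r - 1) * y - r * c powr r"
    using assms by (simp add: powr_diff field_simps)
  ultimately show ?thesis by (simp add: left_diff_distrib)
qed

text \<open>Integrating the tangent inequality \<open>powr_tangent_le\<close> against the weight and choosing \<open>c\<close> as the
weighted mean gives the claim. The tangent inequality at \<open>c = 1\<close> already shows that the left-hand
side is finite when the right-hand side is, which is what makes that choice possible.\<close>

lemma nn_integral_powr_mean_le: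
  fixes w :: "'a \<Rightarrow> real" and y :: "'a \<Rightarrow> ennreal"
  assumes [measurable]: "w \<in> borel_measurable M" "y \<in> borel_measurable M"
    "(\<lambda>x. ennreal_powr (y x) r) \<in> borel_measurable M"
    and r: "1 \<le> r" and W: "(\<integral>\<^sup>+x. ennreal (w x) \<partial>M) = ennreal W" "0 < W"
  shows "ennreal_powr (\<integral>\<^sup>+x. ennreal (w x) * y x \<partial>M) r
           \<le> ennreal (W powr (r - 1)) * (\<integral>\<^sup>+x. ennreal (w x) * ennreal_powr (y x) r \<partial>M)"
    (is "ennreal_powr ?S r \<le> _ * ?T")
proof -
  have tangent: "ennreal (r * c powr (r - 1)) * ?S \<le> ?T + ennreal ((r - 1) * c powr r * W)"
    if c: "0 < c" for c
  proof -
    have pt: "ennreal (r * c powr (r - 1)) * z \<le> ennreal_powr z r + ennreal ((r - 1) * c powr r)" for z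
      using r c powr_tangent_le[OF r c]
      by (cases z) (auto simp: ennreal_powr_ennreal ennreal_mult'[symmetric] simp flip: ennreal_plus intro!: ennreal_leI)
    have "ennreal (r * c powr (r - 1)) * ?S = (\<integral>\<^sup>+x. ennreal (w x) * (ennreal (r * c powr (r - 1)) * y x) \<partial>M)"
      by (subst nn_integral_cmult[symmetric]) (auto simp: mult_ac)
    also have "\<dots> \<le> (\<integral>\<^sup>+x. ennreal (w x) * (ennreal_powr (y x) r + ennreal ((r - 1) * c powr r)) \<partial>M)"
      by (intro nn_integral_mono mult_left_mono pt) auto
    also have "\<dots> = ?T + ennreal W * ennreal ((r - 1) * c powr r)"
      by (simp add: distrib_left nn_integral_add nn_integral_multc W(1))
    also have "\<dots> = ?T + ennreal ((r - 1) * c powr r * W)"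
      using W r by (simp add: ennreal_mult'[symmetric] mult.commute)
    finally show ?thesis .
  qed
  show ?thesis
  proof (cases "?T = top")
    case True
    thus ?thesis using W by (simp add: ennreal_mult_top)
  next
    case False
    then obtain T where T: "?T = ennreal T" "0 \<le> T" by (cases ?T) auto
    have "?S \<noteq> top"
      using tangent[of 1] T r W by (auto simp: ennreal_mult_top top_unique simp flip: ennreal_plus)
    then obtain S where S: "?S = ennreal S" "0 \<le> S" by (cases ?S) auto
    have "S powr r \<le> W powr (r - 1) * T"
    proof (cases "S = 0")
      case True thus ?thesis using T by simp
    next
      case False
      hence S0: "0 < S" using S by simp
      define c where "c = S / W"
      have c: "0 < c" using S0 W by (simp add: c_def)
      have "r * c powr (r - 1) * S \<le> T + (r - 1) * c powr r * W"
        using tangent[OF c] T S r W c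
        by (simp add: ennreal_mult'[symmetric] ennreal_le_iff flip: ennreal_plus)
      moreover have "c powr (r - 1) * S = c powr r * W"
        using c W S0 by (simp add: c_def powr_diff)
      hence "r * c powr (r - 1) * S = r * (c powr r * W)" by simp
      moreover have "(r - 1) * c powr r * W = r * (c powr r * W) - c powr r * W"
        by (simp add: algebra_simps)
      ultimately have "c powr r * W \<le> T" by linarith
      hence "W powr (r - 1) * (c powr r * W) \<le> W powr (r - 1) * T" by (intro mult_left_mono) auto
      moreover have "W powr (r - 1) * (c powr r * W) = S powr r"
        using W S0 by (simp add: c_def powr_diff powr_divide)
      ultimately show ?thesis by simp
    qed
    thus ?thesis using S T W by (simp add: ennreal_powr_ennreal ennreal_mult'[symmetric] ennreal_leI)
  qed
qed

section \<open>Sums over the integers and the discrete Morrey condition\<close>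

abbreviation int_sum :: "(int \<Rightarrow> ennreal) \<Rightarrow> ennreal" where
  "int_sum f \<equiv> \<integral>\<^sup>+i. f i \<partial>count_space UNIV"

lemma int_sum_swap: "int_sum (\<lambda>i. int_sum (\<lambda>j. f i j)) = int_sum (\<lambda>j. int_sum (\<lambda>i. f i j))"
  by (rule nn_integral_count_space_nn_integral) auto

lemma int_sum_shift: "int_sum (\<lambda>n. f (n + k)) = int_sum f"
proof -
  have "bij_betw (\<lambda>n. n + k) UNIV UNIV"
    by (rule bij_betw_byWitness[where f' = "\<lambda>n. n - k"]) auto
  thus ?thesis by (rule nn_integral_bij_count_space)
qed

lemma member_le_int_sum: "f i \<le> int_sum f"
proof -
  have "f i = int_sum (\<lambda>j. f j * indicator {i} j)" by simp
  also have "\<dots> \<le> int_sum f" by (intro nn_integral_mono) (auto split: split_indicator)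
  finally show ?thesis .
qed

lemma int_sum_geometric_finite:
  assumes P: "1 < P" and d: "0 < d"
  shows "int_sum (\<lambda>i. ennreal (P powr (- d * \<bar>real_of_int i\<bar>))) < top"
proof -
  define q where "q = P powr (- d)"
  have q: "0 \<le> q" "q < 1" using P d by (auto simp: q_def powr_less_one)
  have qn: "P powr (- d * real n) = q ^ n" for n
    using P unfolding q_def powr_powr[symmetric] by (simp add: powr_realpow)
  have nat: "(\<integral>\<^sup>+n. ennreal (P powr (- d * real n)) \<partial>count_space UNIV) < top"
    unfolding qn using q by (simp add: nn_integral_count_space_nat suminf_ennreal2 summable_geometric)
  have inj: "inj int" "inj (\<lambda>n. - int n)" by (auto simp: inj_on_def)
  have eq: "(\<integral>\<^sup>+i\<in>range int. ennreal (P powr (- d * \<bar>real_of_int i\<bar>)) \<partial>count_space UNIV) < top"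
    "(\<integral>\<^sup>+i\<in>range (\<lambda>n. - int n). ennreal (P powr (- d * \<bar>real_of_int i\<bar>)) \<partial>count_space UNIV) < top"
    using nat nn_integral_bij_count_space[OF inj_on_imp_bij_betw[OF inj(1)], of "\<lambda>i. ennreal (P powr (- d * \<bar>real_of_int i\<bar>))"]
      nn_integral_bij_count_space[OF inj_on_imp_bij_betw[OF inj(2)], of "\<lambda>i. ennreal (P powr (- d * \<bar>real_of_int i\<bar>))"]
    by (auto simp: nn_integral_count_space_indicator)
  have cover: "i \<in> range int \<or> i \<in> range (\<lambda>n. - int n)" for i
    by (cases i rule: int_cases2) auto
  have "int_sum (\<lambda>i. ennreal (P powr (- d * \<bar>real_of_int i\<bar>)))
     \<le> int_sum (\<lambda>i. ennreal (P powr (- d * \<bar>real_of_int i\<bar>)) * indicator (range int) i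
         + ennreal (P powr (- d * \<bar>real_of_int i\<bar>)) * indicator (range (\<lambda>n. - int n)) i)"
    using cover by (intro nn_integral_mono) (auto split: split_indicator)
  also have "\<dots> < top" using eq by (subst nn_integral_add) auto
  finally show ?thesis .
qed

text \<open>For a function on the \<open>p\<close>-adic numbers that takes the value \<open>h n\<close> on the sphere of radius
\<open>P powr n\<close>, this is, up to the factor \<open>1 - 1 / P\<close>, the integral of its \<open>r\<close>-th power over the ball of
radius \<open>P powr l\<close>.\<close>

definition morrey_sum :: "real \<Rightarrow> real \<Rightarrow> (int \<Rightarrow> ennreal) \<Rightarrow> int \<Rightarrow> ennreal" where
  "morrey_sum P r h l = int_sum (\<lambda>n. ennreal (P powr n) * ennreal_powr (h n) r * indicator {..l} n)"

lemma morrey_sum_mono: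
  assumes "\<And>n. h n \<le> h' n" "0 \<le> r"
  shows "morrey_sum P r h l \<le> morrey_sum P r h' l"
  unfolding morrey_sum_def
  by (intro nn_integral_mono mult_right_mono mult_left_mono ennreal_powr_mono assms) auto

lemma member_le_morrey_sum: "ennreal (P powr n) * ennreal_powr (h n) r \<le> morrey_sum P r h n"
  using member_le_int_sum[of "\<lambda>n'. ennreal (P powr n') * ennreal_powr (h n') r * indicator {..n} n'" n]
  by (simp add: morrey_sum_def)

lemma finite_of_morrey_sum_finite:
  assumes "0 < P" and fin: "morrey_sum P r h n < top"
  shows "h n < top"
proof (rule ccontr)
  assume "\<not> h n < top"
  hence "h n = top" by (simp add: less_top[symmetric])
  thus False using member_le_morrey_sum[of P n h r] fin \<open>0 < P\<close>
    by (simp add: ennreal_mult_top top_unique)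
qed

lemma morrey_sum_shift:
  assumes "1 < P"
  shows "morrey_sum P r (\<lambda>n. h (n + i)) l = ennreal (P powr (- i)) * morrey_sum P r h (l + i)"
proof -
  have "ennreal (P powr (- i)) * morrey_sum P r h (l + i)
     = ennreal (P powr (- i)) * int_sum (\<lambda>n. ennreal (P powr (n + i)) * ennreal_powr (h (n + i)) r * indicator {..l + i} (n + i))"
    unfolding morrey_sum_def by (subst int_sum_shift[symmetric, of _ i]) simp
  also have "\<dots> = int_sum (\<lambda>n. ennreal (P powr (- i)) * (ennreal (P powr (n + i)) * ennreal_powr (h (n + i)) r * indicator {..l + i} (n + i)))"
    by (rule nn_integral_cmult[symmetric]) auto
  also have "\<dots> = morrey_sum P r (\<lambda>n. h (n + i)) l"
    unfolding morrey_sum_def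
  proof (intro nn_integral_cong)
    fix n :: int
    have "ennreal (P powr (- i)) * ennreal (P powr (n + i)) = ennreal (P powr n)"
      using assms by (simp add: ennreal_mult'[symmetric] flip: powr_add)
    thus "ennreal (P powr (- i)) * (ennreal (P powr (n + i)) * ennreal_powr (h (n + i)) r * indicator {..l + i} (n + i))
       = ennreal (P powr n) * ennreal_powr (h (n + i)) r * indicator {..l} n"
      by (simp add: mult.assoc[symmetric] indicator_def)
  qed
  finally show ?thesis ..
qed

text \<open>The scale-invariant form of Minkowski's inequality. The shift by \<open>i\<close> changes the Morrey bound by the
factor \<open>P powr (- i / q)\<close>, so the terms are rescaled by \<open>P powr (i / q)\<close> before the power mean
inequality is applied with the weights \<open>v i * P powr (- i / q)\<close>. After interchanging the two sums,
every shift then contributes the same bound.\<close>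

lemma morrey_sum_convolution_le:
  fixes v :: "int \<Rightarrow> real"
  assumes P: "1 < P" and r: "1 \<le> r" and q: "0 < q"
    and v: "\<And>i. 0 \<le> v i"
    and W: "int_sum (\<lambda>i. ennreal (v i * P powr (- real_of_int i / q))) = ennreal W" "0 < W"
    and A: "\<And>l. morrey_sum P r h l \<le> ennreal (A * P powr (l * (1 - r / q)))" "0 \<le> A"
  shows "morrey_sum P r (\<lambda>n. int_sum (\<lambda>i. ennreal (v i) * h (n + i))) l
           \<le> ennreal (W powr r * A * P powr (l * (1 - r / q)))"
proof -
  define w where "w i = v i * P powr (- real_of_int i / q)" for i :: int
  have w0: "0 \<le> w i" for i using v by (simp add: w_def)
  have vw: "ennreal (v i) * y = ennreal (w i) * (ennreal (P powr (i / q)) * y)" for i y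
  proof -
    have "v i = w i * P powr (i / q)"
      using P by (simp add: w_def powr_minus)
    thus ?thesis using w0 by (simp add: ennreal_mult' mult.assoc)
  qed
  have pt: "ennreal_powr (int_sum (\<lambda>i. ennreal (v i) * h (n + i))) r
      \<le> ennreal (W powr (r - 1)) * int_sum (\<lambda>i. ennreal (w i * P powr (i * r / q)) * ennreal_powr (h (n + i)) r)" for n
  proof -
    have "ennreal_powr (int_sum (\<lambda>i. ennreal (v i) * h (n + i))) r
       \<le> ennreal (W powr (r - 1)) * int_sum (\<lambda>i. ennreal (w i) * ennreal_powr (ennreal (P powr (i / q)) * h (n + i)) r)"
      unfolding vw by (rule nn_integral_powr_mean_le) (use r W in \<open>auto simp: w_def\<close>)
    also have "(\<lambda>i. ennreal (w i) * ennreal_powr (ennreal (P powr (i / q)) * h (n + i)) r)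
       = (\<lambda>i. ennreal (w i * P powr (i * r / q)) * ennreal_powr (h (n + i)) r)"
      using P w0 by (intro ext) (simp add: ennreal_powr_cmult powr_powr ennreal_mult' mult.assoc)
    finally show ?thesis .
  qed
  have "morrey_sum P r (\<lambda>n. int_sum (\<lambda>i. ennreal (v i) * h (n + i))) l
     \<le> int_sum (\<lambda>n. ennreal (P powr n) * (ennreal (W powr (r - 1)) *
          int_sum (\<lambda>i. ennreal (w i * P powr (i * r / q)) * ennreal_powr (h (n + i)) r)) * indicator {..l} n)"
    unfolding morrey_sum_def by (intro nn_integral_mono mult_right_mono mult_left_mono pt) auto
  also have "\<dots> = int_sum (\<lambda>n. int_sum (\<lambda>i. ennreal (W powr (r - 1)) * (ennreal (w i * P powr (i * r / q)) *
          (ennreal (P powr n) * ennreal_powr (h (n + i)) r * indicator {..l} n))))"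
    by (simp add: nn_integral_cmult[symmetric] nn_integral_multc[symmetric] mult_ac)
  also have "\<dots> = int_sum (\<lambda>i. ennreal (W powr (r - 1)) * (ennreal (w i * P powr (i * r / q)) *
          morrey_sum P r (\<lambda>n. h (n + i)) l))"
    unfolding morrey_sum_def by (subst int_sum_swap) (simp add: nn_integral_cmult)
  also have "\<dots> \<le> int_sum (\<lambda>i. ennreal (W powr (r - 1) * A * P powr (l * (1 - r / q))) * ennreal (w i))"
  proof (intro nn_integral_mono)
    fix i :: int
    have "ennreal (w i * P powr (i * r / q)) * morrey_sum P r (\<lambda>n. h (n + i)) l
       \<le> ennreal (w i * P powr (i * r / q)) * (ennreal (P powr (- i)) * ennreal (A * P powr ((l + i) * (1 - r / q))))"
      unfolding morrey_sum_shift[OF P] using A(1)[of "l + i"] by (intro mult_left_mono) auto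
    also have "\<dots> = ennreal (w i * A * (P powr (i * r / q) * P powr (- i) * P powr ((l + i) * (1 - r / q))))"
      using A w0 by (simp add: ennreal_mult'[symmetric] mult_ac)
    also have "P powr (i * r / q) * P powr (- i) * P powr ((l + i) * (1 - r / q)) = P powr (l * (1 - r / q))"
      unfolding powr_add[symmetric] by (rule arg_cong[where f = "\<lambda>x. P powr x"]) (simp add: algebra_simps)
    finally have "ennreal (W powr (r - 1)) * (ennreal (w i * P powr (i * r / q)) * morrey_sum P r (\<lambda>n. h (n + i)) l)
       \<le> ennreal (W powr (r - 1)) * ennreal (w i * A * P powr (l * (1 - r / q)))"
      by (intro mult_left_mono) auto
    also have "\<dots> = ennreal (W powr (r - 1) * A * P powr (l * (1 - r / q))) * ennreal (w i)"
      using A w0 by (simp add: ennreal_mult'[symmetric] mult_ac)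
    finally show "ennreal (W powr (r - 1)) * (ennreal (w i * P powr (i * r / q)) * morrey_sum P r (\<lambda>n. h (n + i)) l)
       \<le> ennreal (W powr (r - 1) * A * P powr (l * (1 - r / q))) * ennreal (w i)" .
  qed
  also have "\<dots> = ennreal (W powr (r - 1) * A * P powr (l * (1 - r / q))) * ennreal W"
    using W by (simp add: nn_integral_cmult w_def)
  also have "\<dots> = ennreal (W powr r * A * P powr (l * (1 - r / q)))"
    using A W by (simp add: ennreal_mult'[symmetric] powr_diff)
  finally show ?thesis .
qed

section \<open>The kernel in the ratio of the two radii\<close>

definition dilation_kernel :: "real \<Rightarrow> real \<Rightarrow> real" where
  "dilation_kernel lam u = u powr (lam / 2) / max 1 u powr (lam + 1)"

lemma dilation_kernel_nonneg: "0 \<le> dilation_kernel lam u"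
  by (simp add: dilation_kernel_def)

text \<open>The terms are exact geometric sequences on each side of \<open>0\<close>: the ratio exponent is
\<open>lam / 2 + 1 - \<beta> - 1 / q\<close> as \<open>i\<close> decreases and \<open>lam / 2 + \<beta> + 1 / q\<close> as \<open>i\<close> increases. The hypotheses make
both positive.\<close>

lemma dilation_kernel_summable:
  assumes P: "1 < P" and q: "0 < q" and \<beta>: "0 \<le> \<beta>" and lam: "0 \<le> lam" "\<beta> + 1 / q < lam / 2 + 1"
  obtains W where "0 < W"
    "int_sum (\<lambda>i. ennreal (dilation_kernel lam (P powr i) * P powr (real_of_int i * (1 - \<beta>)) * P powr (- real_of_int i / q)))
      = ennreal W"
proof -
  define d where "d = min (lam / 2 + 1 - \<beta> - 1 / q) (lam / 2 + \<beta> + 1 / q)"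
  have d: "0 < d" using assms by (auto simp: d_def intro: add_nonneg_pos)
  let ?w = "\<lambda>i::int. dilation_kernel lam (P powr i) * P powr (real_of_int i * (1 - \<beta>)) * P powr (- real_of_int i / q)"
  have le: "?w i \<le> P powr (- d * \<bar>real_of_int i\<bar>)" for i
  proof (cases "i \<ge> 0")
    case True
    have ge: "1 \<le> P powr i" using True P by (simp add: ge_one_powr_ge_zero)
    have "?w i = P powr (i * (lam / 2) - i * (lam + 1) + i * (1 - \<beta>) + - real_of_int i / q)"
      unfolding dilation_kernel_def max_absorb2[OF ge] powr_powr
      by (simp only: powr_add[symmetric] powr_diff[symmetric])
    also have "\<dots> = P powr (- (lam / 2 + \<beta> + 1 / q) * i)"
      by (rule arg_cong[where f = "\<lambda>x. P powr x"]) (simp add: field_simps)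
    also have "\<dots> \<le> P powr (- d * \<bar>real_of_int i\<bar>)"
      using True P mult_right_mono[of d "lam / 2 + \<beta> + 1 / q" "real_of_int i"]
      by (intro powr_mono) (auto simp: d_def left_diff_distrib distrib_right)
    finally show ?thesis .
  next
    case False
    have "P powr i \<le> P powr 0" using False P by (intro powr_mono) auto
    hence "max 1 (P powr i) = 1" using P by simp
    hence "?w i = P powr ((lam / 2 + 1 - \<beta> - 1 / q) * i)"
      using P by (simp add: dilation_kernel_def powr_powr algebra_simps flip: powr_add)
    also have "\<dots> \<le> P powr (- d * \<bar>real_of_int i\<bar>)"
      using False P by (intro powr_mono) (auto simp: d_def intro!: mult_right_mono_neg)
    finally show ?thesis .
  qed
  have "int_sum (\<lambda>i. ennreal (?w i)) \<le> int_sum (\<lambda>i. ennreal (P powr (- d * \<bar>real_of_int i\<bar>)))"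
    by (intro nn_integral_mono ennreal_leI le)
  also have "\<dots> < top" by (rule int_sum_geometric_finite[OF P d])
  finally have "int_sum (\<lambda>i. ennreal (?w i)) \<noteq> top" by simp
  then obtain W where W: "int_sum (\<lambda>i. ennreal (?w i)) = ennreal W" "0 \<le> W"
    by (cases "int_sum (\<lambda>i. ennreal (?w i))") auto
  have "ennreal (?w 0) \<le> ennreal W" using member_le_int_sum[of "\<lambda>i. ennreal (?w i)" 0] W by simp
  \<comment> \<open>the term at \<open>i = 0\<close> is \<open>1\<close>, which keeps the total away from \<open>0\<close>\<close>
  hence "1 \<le> W" using P W by (simp add: dilation_kernel_def flip: ennreal_1)
  thus thesis using W by (intro that[of W]) auto
qed

section \<open>Value group and residue field\<close>

lemma card_gt_1: "1 < real CARD('p :: prime_card)"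
  using prime_gt_1_nat[OF prime_card[where 'a='p]] by simp

definition padic_of_rat :: "rat \<Rightarrow> 'p :: prime_card padic" where
  "padic_of_rat c = abs_padic (\<lambda>_. c)"

lemma abs_padic_diff:
  assumes "padic_cauchy CARD('p) X" "padic_cauchy CARD('p) Y"
  shows "abs_padic X - abs_padic Y = (abs_padic (\<lambda>n. X n - Y n) :: 'p :: prime_card padic)"
  using assms
  by (simp add: minus_padic_def uminus_padic.abs_eq plus_padic.abs_eq padic_rel_refl padic_cauchy_uminus)

lemma padic_of_rat_diff: "padic_of_rat c - padic_of_rat d = padic_of_rat (c - d)"
  unfolding padic_of_rat_def by (rule abs_padic_diff) auto

lemma padic_norm_of_rat: "padic_norm (padic_of_rat c :: 'p :: prime_card padic) = padic_abs CARD('p) c"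
  unfolding padic_of_rat_def
  using padic_norm_of_rat_seq[of "\<lambda>_. c", where 'p='p] by (simp add: LIMSEQ_const_iff)

lemma padic_of_rat_dense:
  fixes x :: "'p :: prime_card padic"
  assumes "0 < e"
  obtains c where "padic_norm (x - padic_of_rat c) \<le> e"
proof -
  obtain X where X: "padic_cauchy CARD('p) X" "x = abs_padic X"
    using Quotient_padic[where 'a='p] unfolding Quotient_def padic_rel_def by metis
  obtain N where N: "\<And>m n. m \<ge> N \<Longrightarrow> n \<ge> N \<Longrightarrow> padic_abs CARD('p) (X m - X n) < e"
    using X(1) assms unfolding padic_cauchy_def by blast
  have eq: "x - padic_of_rat (X N) = abs_padic (\<lambda>n. X n - X N)"
    unfolding X(2) padic_of_rat_def by (rule abs_padic_diff) (auto intro: X)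
  have "padic_cauchy CARD('p) (\<lambda>n. X n - X N)"
    by (intro padic_cauchy_diff prime_card X padic_cauchy_const)
  from padic_norm_of_rat_seq[OF this]
  have "padic_norm (x - padic_of_rat (X N)) \<le> e"
    unfolding eq by (rule LIMSEQ_le_const2) (use N in \<open>auto intro!: exI[of _ N] less_imp_le\<close>)
  thus thesis by (rule that)
qed

lemma padic_norm_minus_commute: "padic_norm (x - y) = padic_norm (y - x)"
  using padic_norm_uminus[of "x - y"] by simp

lemma padic_norm_diff_le_max: "padic_norm (x - z) \<le> max (padic_norm (x - y)) (padic_norm (y - z))"
  using padic_norm_add_le_max[of "x - y" "y - z"] by simp

text \<open>Every triangle is isosceles with the two longer sides equal.\<close>

lemma padic_norm_eq_of_close:
  assumes "padic_norm (x - y) < padic_norm y"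
  shows "padic_norm x = padic_norm y"
  using assms padic_norm_add_le_max[of "x - y" y] padic_norm_add_le_max[of "y - x" x]
  by (auto simp: padic_norm_minus_commute max_def split: if_splits)

lemma padic_norm_0 [simp]: "padic_norm 0 = 0"
  by (simp add: padic_norm_eq_0_iff)

lemma padic_norm_pos_iff: "0 < padic_norm x \<longleftrightarrow> x \<noteq> 0"
  using padic_norm_nonneg[of x] padic_norm_eq_0_iff[of x] by linarith

lemma padic_abs_power_int:
  assumes "prime p"
  shows "padic_abs p (of_nat p powi n) = real p powi (- n)"
proof -
  have p0: "p \<noteq> 0" "\<not> is_unit p" using assms by auto
  have m: "multiplicity (int p) (int p ^ k) = k" for k
    using assms by (intro multiplicity_same_power) (auto simp: prime_nat_iff)
  show ?thesis
  proof (cases "n \<ge> 0")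
    case True
    then obtain k where n: "n = int k" by (metis nonneg_int_cases)
    have "padic_abs p (of_int (int p ^ k) / of_int 1) = real p powi (- n)"
      using p0 by (subst padic_abs_fract[OF assms]) (auto simp: m n)
    thus ?thesis by (simp add: n)
  next
    case False
    then obtain k where n: "n = - int k" by (metis linear minus_minus nonneg_int_cases neg_0_le_iff_le)
    have "padic_abs p (of_int 1 / of_int (int p ^ k)) = real p powi (- n)"
      using p0 by (subst padic_abs_fract[OF assms]) (auto simp: m n)
    thus ?thesis by (simp add: n power_int_minus field_simps)
  qed
qed

text \<open>A nonzero number has the same norm as any rational that is close enough to it, and the norm of a
rational is a power of the prime by definition.\<close>

lemma padic_norm_cases:
  fixes x :: "'p :: prime_card padic"
  assumes "x \<noteq> 0"
  obtains n where "padic_norm x = real CARD('p) powi n"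
proof -
  have pos: "0 < padic_norm x / 2" using assms by (simp add: padic_norm_pos_iff)
  obtain c where c: "padic_norm (x - padic_of_rat c) \<le> padic_norm x / 2"
    using padic_of_rat_dense[OF pos] .
  have "padic_norm (padic_of_rat c :: 'p padic) = padic_norm x"
    using padic_norm_eq_of_close[of "padic_of_rat c" x] c pos
    by (simp add: padic_norm_minus_commute[of "padic_of_rat c"])
  hence "padic_norm x = padic_abs CARD('p) c" "c \<noteq> 0"
    using pos by (auto simp: padic_norm_of_rat)
  thus thesis using that by (simp add: padic_abs_def)
qed

text \<open>The digits \<open>0, \<dots>, p - 1\<close> represent all residues of \<open>p\<close>-integral rationals: for \<open>y = a / b\<close> in lowest
terms, \<open>b\<close> is prime to \<open>p\<close>, and \<open>d\<close> is \<open>a\<close> times an inverse of \<open>b\<close> modulo \<open>p\<close>.\<close>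

lemma padic_residue:
  assumes p: "prime p" and y: "padic_abs p y \<le> 1"
  obtains d where "d < p" "padic_abs p (y - of_nat d) \<le> real p powi (- 1)"
proof (cases "y = 0")
  case True
  thus thesis using that[of 0] prime_gt_0_nat[OF p] by simp
next
  case False
  obtain a b where ab: "quotient_of y = (a, b)" by fastforce
  have y': "y = of_int a / of_int b" using quotient_of_div[OF ab] .
  have b0: "b > 0" using quotient_of_denom_pos[OF ab] .
  have cop: "coprime a b" using quotient_of_coprime[OF ab] .
  have a0: "a \<noteq> 0" using False y' by auto
  have p1: "1 < real p" using prime_gt_1_nat[OF p] by simp
  have pe: "prime (int p)" using p by simp
  have "real p powi (int (multiplicity (int p) b) - int (multiplicity (int p) a)) \<le> real p powi 0"
    using y padic_abs_fract[OF p a0, of b] b0 unfolding y' by simp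
  hence le: "multiplicity (int p) b \<le> multiplicity (int p) a"
    using p1 by (smt (verit) power_int_strict_increasing of_nat_le_iff)
  have nb: "\<not> int p dvd b"
  proof
    assume d: "int p dvd b"
    hence "multiplicity (int p) b > 0" using b0 pe by (simp add: prime_multiplicity_gt_zero_iff)
    hence "int p dvd a" using le not_dvd_imp_multiplicity_0[of "int p" a] by (cases "int p dvd a") auto
    hence "is_unit (int p)" using d cop coprime_common_divisor by blast
    with pe show False using not_prime_unit by blast
  qed
  hence "gcd b (int p) = 1"
    using prime_imp_coprime[OF pe nb] by (simp add: coprime_commute coprime_iff_gcd_eq_1)
  then obtain u v where uv: "u * b + v * int p = 1" using bezout_int[of b "int p"] by metis
  define d where "d = nat ((a * u) mod int p)"
  have p0: "0 < int p" using prime_gt_0_nat[OF p] by simp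
  have d: "int d = (a * u) mod int p" using p0 by (simp add: d_def)
  have dp: "d < p" using pos_mod_bound[OF p0, of "a * u"] unfolding d[symmetric] by simp
  have "int p dvd a * u - int d" unfolding d by (simp add: minus_mod_eq_mult_div)
  moreover have "a - b * int d = b * (a * u - int d) + int p * (a * v)"
  proof -
    have "a = a * (u * b + v * int p)" using uv by simp
    thus ?thesis by (simp add: algebra_simps)
  qed
  ultimately have dv: "int p dvd a - b * int d" by simp
  have eq: "y - of_nat d = of_int (a - b * int d) / of_int b" using b0 by (simp add: y' field_simps)
  have "padic_abs p (y - of_nat d) \<le> real p powi (- 1)"
  proof (cases "a - b * int d = 0")
    case True thus ?thesis unfolding eq by simp
  next
    case nz: False
    hence "multiplicity (int p) (a - b * int d) > 0" using dv pe by (simp add: prime_multiplicity_gt_zero_iff)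
    moreover have "multiplicity (int p) b = 0" using nb by (simp add: not_dvd_imp_multiplicity_0)
    ultimately have "real p powi (int (multiplicity (int p) b) - int (multiplicity (int p) (a - b * int d)))
        \<le> real p powi (- 1)"
      using p1 by (intro power_int_increasing) auto
    thus ?thesis unfolding eq using b0 nz by (subst padic_abs_fract[OF p]) auto
  qed
  thus thesis using dp that by blast
qed

lemma padic_abs_of_nat_diff:
  assumes p: "prime p" and "d < p" "e < p" "d \<noteq> e"
  shows "padic_abs p (of_nat d - of_nat e) = 1"
proof -
  have nd: "\<not> int p dvd (int d - int e)"
  proof
    assume "int p dvd (int d - int e)"
    moreover have "\<bar>int d - int e\<bar> < int p" "int d - int e \<noteq> 0" using assms by auto
    ultimately show False using zdvd_imp_le[of "int p" "\<bar>int d - int e\<bar>"] by auto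
  qed
  hence "multiplicity (int p) (int d - int e) = 0" by (rule not_dvd_imp_multiplicity_0)
  thus ?thesis using padic_abs_fract[OF p, of "int d - int e" 1] assms by simp
qed

text \<open>The ball of radius \<open>p powi (l + 1)\<close> is a scaled copy of the ring of integers, and the \<open>p\<close> balls are
its cosets, which the scaled digits represent. This is the only point where the size of the residue
field enters; it fixes the Haar measure of all balls. It suffices to treat rational centres since
rationals are dense.\<close>

lemma padic_ball_refine:
  fixes l :: int
  defines "c \<equiv> \<lambda>d. padic_of_rat (of_nat d * of_nat CARD('p) powi (- (l + 1))) :: 'p :: prime_card padic"
  shows "padic_ball 0 (l + 1) = (\<Union>d<CARD('p). padic_ball (c d) l)"
    and "disjoint_family_on (\<lambda>d. padic_ball (c d) l) {..<CARD('p)}"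
proof -
  let ?p = "CARD('p)"
  note pr = prime_card[where 'a='p]
  have p1: "1 < real ?p" by (rule card_gt_1)
  have abs_scale: "padic_abs ?p (z * of_nat ?p powi n) = padic_abs ?p z * real ?p powi (- n)" for z n
    by (simp add: padic_abs_mult[OF pr] padic_abs_power_int[OF pr])
  have le: "real ?p powi l \<le> real ?p powi (l + 1)" "real ?p powi l < real ?p powi (l + 1)"
    using p1 by (auto intro: power_int_increasing power_int_strict_increasing)
  show "padic_ball 0 (l + 1) = (\<Union>d<?p. padic_ball (c d) l)" (is "?L = ?R")
  proof (intro Set.set_eqI iffI)
    fix x assume "x \<in> ?L"
    hence x: "padic_norm x \<le> real ?p powi (l + 1)" by (simp add: padic_ball_def)
    obtain y where y: "padic_norm (x - padic_of_rat y) \<le> real ?p powi l"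
      using padic_of_rat_dense[of "real ?p powi l" x] p1 by auto
    have "padic_abs ?p y \<le> real ?p powi (l + 1)"
      using padic_norm_add_le_max[of "padic_of_rat y - x" x] x y le
      by (simp add: padic_norm_of_rat padic_norm_minus_commute)
    hence "padic_abs ?p (y * of_nat ?p powi (l + 1)) \<le> real ?p powi (l + 1) * real ?p powi (- (l + 1))"
      unfolding abs_scale using p1 by (intro mult_right_mono) auto
    also have "\<dots> = 1" using p1 by (simp add: power_int_minus del: minus_add_distrib)
    finally obtain d where d: "d < ?p"
      "padic_abs ?p (y * of_nat ?p powi (l + 1) - of_nat d) \<le> real ?p powi (- 1)"
      by (rule padic_residue[OF pr])
    have "of_nat ?p powi (l + 1) * of_nat ?p powi (- (l + 1)) = (1 :: rat)"
      using p1 by (simp add: power_int_minus del: minus_add_distrib)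
    hence "y - of_nat d * of_nat ?p powi (- (l + 1))
        = (y * of_nat ?p powi (l + 1) - of_nat d) * of_nat ?p powi (- (l + 1))"
      by (simp only: left_diff_distrib mult.assoc mult_1_right)
    hence "padic_abs ?p (y - of_nat d * of_nat ?p powi (- (l + 1)))
        \<le> real ?p powi (- 1) * real ?p powi (l + 1)"
      using d(2) p1 by (simp only: abs_scale minus_minus) (intro mult_right_mono, auto)
    also have "\<dots> = real ?p powi l" using p1 by (subst power_int_add[symmetric]) auto
    finally have "padic_norm (padic_of_rat y - c d) \<le> real ?p powi l"
      unfolding c_def padic_of_rat_diff padic_norm_of_rat .
    hence "padic_norm (x - c d) \<le> real ?p powi l"
      using padic_norm_diff_le_max[of x "c d" "padic_of_rat y"] y by simp
    thus "x \<in> ?R" using d(1) by (auto simp: padic_ball_def)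
  next
    fix x assume "x \<in> ?R"
    then obtain d where d: "d < ?p" "padic_norm (x - c d) \<le> real ?p powi l"
      by (auto simp: padic_ball_def)
    have "padic_abs ?p (of_nat d) \<le> 1"
      using padic_abs_of_nat_diff[OF pr d(1) prime_gt_0_nat[OF pr]] by (cases "d = 0") auto
    hence "padic_norm (c d) \<le> 1 * real ?p powi (l + 1)"
      unfolding c_def padic_norm_of_rat abs_scale minus_minus using p1 by (intro mult_right_mono) auto
    thus "x \<in> ?L"
      using padic_norm_add_le_max[of "x - c d" "c d"] d le by (simp add: padic_ball_def)
  qed
  show "disjoint_family_on (\<lambda>d. padic_ball (c d) l) {..<?p}"
    unfolding disjoint_family_on_def
  proof (intro ballI impI)
    fix d e assume de: "d \<in> {..<?p}" "e \<in> {..<?p}" "d \<noteq> e"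
    have "padic_norm (c d - c e) = real ?p powi (l + 1)"
      unfolding c_def padic_of_rat_diff padic_norm_of_rat left_diff_distrib[symmetric]
        abs_scale minus_minus using padic_abs_of_nat_diff[OF pr, of d e] de by simp
    moreover have "padic_norm (c d - c e) \<le> real ?p powi l"
      if "x \<in> padic_ball (c d) l" "x \<in> padic_ball (c e) l" for x
      using that padic_norm_diff_le_max[of "c d" "c e" x]
      by (simp add: padic_ball_def padic_norm_minus_commute[of "c d" x])
    ultimately show "padic_ball (c d) l \<inter> padic_ball (c e) l = {}"
      using le(2) by (metis disjoint_iff not_less)
  qed
qed

section \<open>Haar measure of balls and spheres\<close>

lemma padic_norm_eq_dist: "padic_norm x = dist x 0"
  by (simp add: dist_padic_def)

lemma padic_ball_eq_cball: "padic_ball a l = cball (a :: 'p :: prime_card padic) (real CARD('p) powi l)"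
  by (auto simp: padic_ball_def dist_padic_def padic_norm_minus_commute)

lemma padic_norm_measurable: "padic_norm \<in> borel_measurable borel"
proof -
  have "continuous_on UNIV (\<lambda>x :: 'a padic. dist x 0)" by (intro continuous_intros)
  thus ?thesis unfolding padic_norm_eq_dist[abs_def] by (rule borel_measurable_continuous_onI)
qed

text \<open>The radix \<open>P\<close> is a parameter because an abbreviation for \<open>real CARD('p)\<close> would have to carry the
type \<open>'p\<close> as an extra argument.\<close>

locale padic_haar =
  fixes M :: "'p :: prime_card padic measure" and P :: real
  assumes haar: "normalized_haar M" and P_def: "P = real CARD('p)"
begin

lemma P_gt_1: "1 < P" unfolding P_def by (rule card_gt_1)

lemma sets_M [measurable_cong, simp]: "sets M = sets borel"
  using haar by (simp add: normalized_haar_def)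

lemma space_M [simp]: "space M = UNIV"
  using sets_eq_imp_space_eq[OF sets_M] by simp

lemma norm_measurable [measurable]: "padic_norm \<in> borel_measurable M"
  using padic_norm_measurable by (simp add: measurable_cong_sets[OF sets_M refl])

lemma singleton_sets [measurable]: "{a} \<in> sets M"
  by simp

lemma ball_sets [measurable]: "padic_ball a l \<in> sets M"
  by (simp add: padic_ball_eq_cball)

lemma emeasure_ball_translate: "emeasure M (padic_ball a l) = emeasure M (padic_ball 0 l)"
proof -
  have "x \<in> (+) a ` padic_ball 0 l" if "x \<in> padic_ball a l" for x
    using that by (intro image_eqI[of _ _ "x - a"]) (auto simp: padic_ball_def)
  hence "padic_ball a l = (+) a ` padic_ball 0 l"
    by (auto simp: padic_ball_def)
  moreover have "padic_ball (0 :: 'p padic) l \<in> sets borel"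
    using ball_sets[of 0 l] unfolding sets_M .
  ultimately show ?thesis using haar unfolding normalized_haar_def by metis
qed

lemma emeasure_ball_Suc: "emeasure M (padic_ball 0 (l + 1)) = ennreal P * emeasure M (padic_ball 0 l)"
proof -
  let ?c = "\<lambda>d. padic_of_rat (of_nat d * of_nat CARD('p) powi (- (l + 1))) :: 'p padic"
  have "emeasure M (padic_ball 0 (l + 1)) = (\<Sum>d<CARD('p). emeasure M (padic_ball (?c d) l))"
    unfolding padic_ball_refine(1) by (rule sum_emeasure[symmetric]) (use padic_ball_refine(2) in \<open>blast intro: ball_sets\<close>)+
  also have "\<dots> = (\<Sum>d<CARD('p). emeasure M (padic_ball 0 l))"
    by (intro sum.cong refl emeasure_ball_translate)
  finally show ?thesis by (simp add: P_def ennreal_of_nat_eq_real_of_nat)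
qed

text \<open>Passing to the next larger ball multiplies the measure by \<open>P\<close>, in both directions from the
normalized ball \<open>l = 0\<close>.\<close>

lemma emeasure_ball: "emeasure M (padic_ball a l) = ennreal (P powr l)"
proof -
  have "emeasure M (padic_ball 0 l) = ennreal (P powr l)"
  proof (induction l rule: int_induct[where k=0])
    case base
    show ?case using haar P_gt_1 by (simp add: normalized_haar_def padic_ball_def)
  next
    case (step1 i)
    thus ?case using P_gt_1 by (simp add: emeasure_ball_Suc powr_add ennreal_mult'[symmetric] mult.commute)
  next
    case (step2 i)
    have "ennreal P * emeasure M (padic_ball 0 (i - 1)) = ennreal (P powr i)"
      using emeasure_ball_Suc[of "i - 1"] step2 by simp
    also have "\<dots> = ennreal P * ennreal (P powr (i - 1))"
      using P_gt_1 by (simp add: powr_diff ennreal_mult'[symmetric])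
    finally show ?case
      using P_gt_1 by (subst (asm) ennreal_mult_cancel_left) auto
  qed
  thus ?thesis by (subst emeasure_ball_translate)
qed

lemma measure_ball: "measure M (padic_ball a l) = P powr l"
  by (simp add: measure_def emeasure_ball)

end

text \<open>The exponent of the norm, that is, minus the \<open>p\<close>-adic valuation; its value at \<open>0\<close> is arbitrary.\<close>

definition padic_exponent :: "'p :: prime_card padic \<Rightarrow> int" where
  "padic_exponent x = \<lfloor>log (real CARD('p)) (padic_norm x)\<rfloor>"

definition padic_sphere :: "int \<Rightarrow> 'p :: prime_card padic set" where
  "padic_sphere n = {x. x \<noteq> 0 \<and> padic_exponent x = n}"

context padic_haar
begin

lemma norm_eq_exponent:
  assumes "x \<noteq> 0"
  shows "padic_norm (x :: 'p padic) = P powr (padic_exponent x)"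
proof -
  obtain n where "padic_norm x = P powi n"
    using padic_norm_cases[OF assms] unfolding P_def by blast
  hence n: "padic_norm x = P powr n"
    using P_gt_1 by (simp add: powr_real_of_int')
  hence "padic_exponent x = n"
    using P_gt_1 unfolding padic_exponent_def P_def[symmetric] by simp
  thus ?thesis using n by simp
qed

lemma padic_ball_eq: "padic_ball a l = {x :: 'p padic. padic_norm (x - a) \<le> P powr l}"
  using P_gt_1 by (simp add: padic_ball_def powr_real_of_int' flip: P_def)

lemma in_ball_0_iff: "x \<in> padic_ball 0 l \<longleftrightarrow> x = (0 :: 'p padic) \<or> padic_exponent x \<le> l"
  using P_gt_1 by (cases "x = 0") (auto simp: padic_ball_eq norm_eq_exponent)

lemma exponent_measurable [measurable]: "padic_exponent \<in> measurable M (count_space UNIV)"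
  unfolding padic_exponent_def[abs_def] by measurable

lemma sphere_sets [measurable]: "padic_sphere n \<in> sets M"
proof -
  have "padic_sphere n = (padic_exponent -` {n} \<inter> space M) - {0}"
    by (auto simp: padic_sphere_def)
  also have "\<dots> \<in> sets M"
    by (rule sets.Diff[OF measurable_sets[OF exponent_measurable] singleton_sets]) simp
  finally show ?thesis .
qed

lemma emeasure_sphere: "emeasure M (padic_sphere n) = ennreal ((1 - 1 / P) * P powr n)"
proof -
  have eq: "padic_sphere n = padic_ball 0 n - padic_ball (0 :: 'p padic) (n - 1)"
    by (auto simp: padic_sphere_def in_ball_0_iff)
  have sub: "padic_ball (0 :: 'p padic) (n - 1) \<subseteq> padic_ball 0 n"
    by (auto simp: in_ball_0_iff)
  have fin: "emeasure M (padic_ball 0 (n - 1)) \<noteq> \<infinity>"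
    by (simp add: emeasure_ball)
  have "emeasure M (padic_sphere n) = ennreal (P powr n) - ennreal (P powr (n - 1))"
    unfolding eq emeasure_Diff[OF fin ball_sets ball_sets sub] by (simp only: emeasure_ball of_int_diff of_int_1)
  also have "\<dots> = ennreal (P powr n - P powr (n - 1))"
    by (rule ennreal_minus) simp
  also have "P powr n - P powr (n - 1) = (1 - 1 / P) * P powr n"
    using P_gt_1 by (simp add: powr_diff algebra_simps)
  finally show ?thesis .
qed

text \<open>The spheres partition the nonzero numbers. The condition at \<open>0\<close> replaces the fact that the origin
is a null set.\<close>

lemma nn_integral_spheres:
  assumes [measurable]: "u \<in> borel_measurable M" and u0: "u 0 = 0"
  shows "(\<integral>\<^sup>+x. u x \<partial>M) = int_sum (\<lambda>n. \<integral>\<^sup>+x\<in>padic_sphere n. u x \<partial>M)"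
proof -
  have "u x = int_sum (\<lambda>n. u x * indicator (padic_sphere n) x)" for x
  proof (cases "x = 0")
    case False
    hence "indicator (padic_sphere n) x = (indicator {padic_exponent x} n :: ennreal)" for n
      by (auto simp: padic_sphere_def split: split_indicator)
    thus ?thesis by simp
  qed (simp add: u0)
  hence "(\<integral>\<^sup>+x. u x \<partial>M) = (\<integral>\<^sup>+x. int_sum (\<lambda>n. u x * indicator (padic_sphere n) x) \<partial>M)"
    by presburger
  also have "\<dots> = int_sum (\<lambda>n. \<integral>\<^sup>+x\<in>padic_sphere n. u x \<partial>M)"
    by (rule nn_integral_count_space_nn_integral) auto
  finally show ?thesis .
qed

lemma nn_integral_sphere_const:
  assumes "\<And>x. x \<in> padic_sphere n \<Longrightarrow> u x = c"
  shows "(\<integral>\<^sup>+x\<in>padic_sphere n. u x \<partial>M) = c * ennreal ((1 - 1 / P) * P powr n)"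
proof -
  have "(\<integral>\<^sup>+x\<in>padic_sphere n. u x \<partial>M) = (\<integral>\<^sup>+x. c * indicator (padic_sphere n) x \<partial>M)"
    using assms by (intro nn_integral_cong) (auto split: split_indicator)
  also have "\<dots> = c * ennreal ((1 - 1 / P) * P powr n)"
    by (subst nn_integral_cmult_indicator) (simp_all only: sphere_sets emeasure_sphere)
  finally show ?thesis .
qed

section \<open>The Cesaro--Morrey norm as a discrete quantity\<close>

definition ball_mass :: "('p padic \<Rightarrow> complex) \<Rightarrow> int \<Rightarrow> ennreal" where
  "ball_mass f n = (\<integral>\<^sup>+t\<in>padic_ball 0 n. ennreal (norm (f t)) \<partial>M)"

definition sphere_mass :: "('p padic \<Rightarrow> complex) \<Rightarrow> int \<Rightarrow> ennreal" where
  "sphere_mass f n = (\<integral>\<^sup>+t\<in>padic_sphere n. ennreal (norm (f t)) \<partial>M)"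

definition cesaro_mean :: "real \<Rightarrow> ('p padic \<Rightarrow> complex) \<Rightarrow> int \<Rightarrow> ennreal" where
  "cesaro_mean \<beta> f n = ennreal (P powr (n * (\<beta> - 1))) * ball_mass f n"

text \<open>The integrand of the norm is a function of the exponent alone. At the origin the weight is \<open>0\<close>, so
both sides vanish there.\<close>

lemma cesaro_integrand:
  fixes x :: "'p padic"
  shows "ennreal_powr (ennreal (1 / padic_norm x powr (1 - \<beta>)) *
      (\<integral>\<^sup>+t\<in>{t. padic_norm t \<le> padic_norm x}. ennreal (norm (f t)) \<partial>M)) r
   = (if x = 0 then 0 else ennreal_powr (cesaro_mean \<beta> f (padic_exponent x)) r)"
proof (cases "x = 0")
  case False
  have "{t :: 'p padic. padic_norm t \<le> padic_norm x} = padic_ball 0 (padic_exponent x)"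
    using norm_eq_exponent[OF False] by (simp add: padic_ball_eq)
  moreover have "1 / padic_norm x powr (1 - \<beta>) = P powr (padic_exponent x * (\<beta> - 1))"
  proof -
    have "1 / padic_norm x powr (1 - \<beta>) = padic_norm x powr (- (1 - \<beta>))"
      by (rule powr_minus_divide[symmetric])
    also have "\<dots> = P powr (padic_exponent x * - (1 - \<beta>))"
      by (simp only: norm_eq_exponent[OF False] powr_powr)
    finally show ?thesis by (simp only: minus_diff_eq)
  qed
  ultimately show ?thesis using False unfolding cesaro_mean_def ball_mass_def by (simp only: if_False)
qed simp

lemma nn_integral_cesaro_ball_0:
  "(\<integral>\<^sup>+x\<in>padic_ball 0 l. (if x = 0 then 0 else ennreal_powr (h (padic_exponent x)) r) \<partial>M)
     = ennreal (1 - 1 / P) * morrey_sum P r h l"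
proof -
  let ?u = "\<lambda>x :: 'p padic. (if x = 0 then 0 else ennreal_powr (h (padic_exponent x)) r)"
  have "(\<lambda>x. ennreal_powr (h (padic_exponent x)) r) \<in> borel_measurable M"
    by (rule measurable_compose[OF exponent_measurable]) simp
  hence u: "?u \<in> borel_measurable M"
    by (rule measurable_If[rotated]) auto
  have c: "0 \<le> 1 - 1 / P" using P_gt_1 by simp
  have sph: "(\<integral>\<^sup>+x\<in>padic_sphere n. (?u x * indicator (padic_ball 0 l) x) \<partial>M)
      = ennreal (1 - 1 / P) * (ennreal (P powr n) * ennreal_powr (h n) r * indicator {..l} n)" for n
  proof -
    have "(\<integral>\<^sup>+x\<in>padic_sphere n. (?u x * indicator (padic_ball 0 l) x) \<partial>M)
        = (ennreal_powr (h n) r * indicator {..l} n) * ennreal ((1 - 1 / P) * P powr n)"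
      by (rule nn_integral_sphere_const) (auto simp: padic_sphere_def in_ball_0_iff split: split_indicator)
    also have "\<dots> = ennreal (1 - 1 / P) * (ennreal (P powr n) * ennreal_powr (h n) r * indicator {..l} n)"
      unfolding ennreal_mult'[OF c] by (simp only: mult_ac)
    finally show ?thesis .
  qed
  have "(\<integral>\<^sup>+x\<in>padic_ball 0 l. ?u x \<partial>M) = int_sum (\<lambda>n. \<integral>\<^sup>+x\<in>padic_sphere n. (?u x * indicator (padic_ball 0 l) x) \<partial>M)"
    by (rule nn_integral_spheres)
       (intro borel_measurable_times_ennreal u borel_measurable_indicator ball_sets, simp)
  also have "\<dots> = ennreal (1 - 1 / P) * morrey_sum P r h l"
    unfolding sph morrey_sum_def by (rule nn_integral_cmult) auto
  finally show ?thesis .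
qed

lemma cesaro_morrey_norm_eq:
  "cesaro_morrey_norm M \<beta> r q f = (SUP a. SUP l. ennreal (P powr (l * (1 / q - 1 / r))) *
      ennreal_powr (\<integral>\<^sup>+x\<in>padic_ball a l.
        (if x = 0 then 0 else ennreal_powr (cesaro_mean \<beta> f (padic_exponent x)) r) \<partial>M) (1 / r))"
  unfolding cesaro_morrey_norm_def cesaro_integrand measure_ball powr_powr ..

lemma P_powr_mult_le_iff:
  assumes "0 \<le> N"
  shows "ennreal (P powr s) * y \<le> ennreal N \<longleftrightarrow> y \<le> ennreal (N * P powr (- s))"
proof (cases y)
  case (real u)
  have "P powr s * u \<le> N \<longleftrightarrow> u \<le> N * P powr (- s)"
    using P_gt_1 by (simp add: powr_minus field_simps)
  thus ?thesis using real assms by (simp add: ennreal_mult'[symmetric] ennreal_le_iff)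
next
  case top
  thus ?thesis using P_gt_1 by (simp add: ennreal_mult_top top_unique)
qed

text \<open>Taking \<open>r\<close>-th powers in one term of the supremum and moving the power of \<open>P\<close> to the other side.\<close>

lemma ball_0_term_le_iff:
  assumes "1 \<le> r" "0 \<le> N"
  shows "ennreal (P powr (l * (1 / q - 1 / r))) * ennreal_powr y (1 / r) \<le> ennreal N
     \<longleftrightarrow> y \<le> ennreal (N powr r * P powr (l * (1 - r / q)))"
proof -
  have "(N * P powr (- (l * (1 / q - 1 / r)))) powr r = N powr r * P powr (l * (1 - r / q))"
  proof -
    have "- (l * (1 / q - 1 / r)) * r = l * (1 - r / q)"
      using assms by (simp add: right_diff_distrib left_diff_distrib)
    thus ?thesis using assms by (simp only: powr_mult powr_powr powr_ge_zero)
  qed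
  thus ?thesis using assms
    by (subst P_powr_mult_le_iff) (auto simp: ennreal_powr_le_iff)
qed

text \<open>One direction of the discrete description of the norm: the balls about the origin are among those in
the supremum. The factor \<open>2\<close> bounds \<open>1 / (1 - 1 / P)\<close> for every prime.\<close>

lemma morrey_sum_le_of_cesaro_morrey_norm_le:
  assumes r: "1 \<le> r" and N: "0 \<le> N" "cesaro_morrey_norm M \<beta> r q f \<le> ennreal N"
  shows "morrey_sum P r (cesaro_mean \<beta> f) l \<le> ennreal (2 * N powr r * P powr (l * (1 - r / q)))"
proof -
  let ?s = "morrey_sum P r (cesaro_mean \<beta> f) l"
  have "ennreal (P powr (l * (1 / q - 1 / r))) * ennreal_powr (ennreal (1 - 1 / P) * ?s) (1 / r) \<le> ennreal N"
    unfolding nn_integral_cesaro_ball_0[symmetric]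
    by (rule order_trans[OF _ N(2)[unfolded cesaro_morrey_norm_eq]]) (intro SUP_upper2[of 0] SUP_upper2[of l], auto)
  hence le: "ennreal (1 - 1 / P) * ?s \<le> ennreal (N powr r * P powr (l * (1 - r / q)))"
    using r N by (simp add: ball_0_term_le_iff)
  have "2 \<le> P" using prime_ge_2_nat[OF prime_card[where 'a='p]] by (simp add: P_def)
  hence "1 \<le> 2 * (1 - 1 / P)" by (simp add: field_simps)
  hence "1 * ?s \<le> ennreal (2 * (1 - 1 / P)) * ?s"
    by (intro mult_right_mono) (auto simp flip: ennreal_1 intro: ennreal_leI)
  also have "\<dots> = 2 * (ennreal (1 - 1 / P) * ?s)"
    using P_gt_1 by (subst ennreal_mult') (auto simp: mult.assoc)
  also have "\<dots> \<le> 2 * ennreal (N powr r * P powr (l * (1 - r / q)))"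
    using le by (intro mult_left_mono) auto
  also have "\<dots> = ennreal (2 * N powr r * P powr (l * (1 - r / q)))"
    by (simp add: ennreal_mult' mult.assoc)
  finally show ?thesis by simp
qed

text \<open>The other direction: every point of a ball is a centre, so a ball that contains the origin is a ball about it.
Otherwise \<open>padic_norm\<close> is constant on the ball, with an exponent \<open>n > l\<close>, and the integral is
\<open>P powr (l - n)\<close> times the single term of index \<open>n\<close> of the sum for the ball of radius \<open>P powr n\<close>
about the origin.\<close>

lemma cesaro_morrey_norm_le_of_morrey_sum_le:
  assumes r: "1 \<le> r" "0 < q" and N: "0 \<le> N"
    and le: "\<And>l. morrey_sum P r (cesaro_mean \<beta> f) l \<le> ennreal (N powr r * P powr (l * (1 - r / q)))"
  shows "cesaro_morrey_norm M \<beta> r q f \<le> ennreal N"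
  unfolding cesaro_morrey_norm_eq
proof (rule SUP_least, rule SUP_least)
  fix a :: "'p padic" and l :: int
  let ?h = "cesaro_mean \<beta> f"
  let ?I = "\<integral>\<^sup>+x\<in>padic_ball a l. (if x = 0 then 0 else ennreal_powr (?h (padic_exponent x)) r) \<partial>M"
  have "?I \<le> ennreal (N powr r * P powr (l * (1 - r / q)))"
  proof (cases "a \<in> padic_ball 0 l")
    case True
    hence "padic_norm x \<le> P powr l" if "padic_norm (x - a) \<le> P powr l" for x
      using that padic_norm_add_le_max[of "x - a" a] by (simp add: padic_ball_eq)
    hence "padic_ball a l \<subseteq> padic_ball 0 l" by (auto simp: padic_ball_eq)
    hence "?I \<le> (\<integral>\<^sup>+x\<in>padic_ball 0 l. (if x = 0 then 0 else ennreal_powr (?h (padic_exponent x)) r) \<partial>M)"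
      by (intro nn_integral_mono) (auto split: split_indicator)
    also have "\<dots> \<le> 1 * morrey_sum P r ?h l"
      unfolding nn_integral_cesaro_ball_0 using P_gt_1
      by (intro mult_right_mono) (auto simp flip: ennreal_1 intro!: ennreal_leI)
    finally show ?thesis using le[of l] by simp
  next
    case False
    define n where "n = padic_exponent a"
    have a0: "a \<noteq> 0" and ln: "l < n" using False by (auto simp: in_ball_0_iff n_def)
    have na: "padic_norm a = P powr n" using norm_eq_exponent[OF a0] by (simp add: n_def)
    have const: "x \<noteq> 0 \<and> padic_exponent x = n" if "x \<in> padic_ball a l" for x
    proof -
      have "padic_norm (x - a) < padic_norm a"
        using that ln P_gt_1 unfolding na padic_ball_eq by (auto intro: le_less_trans powr_less_mono)
      hence "padic_norm x = P powr n" using padic_norm_eq_of_close na by metis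
      moreover from this have "x \<noteq> 0" using P_gt_1 by auto
      ultimately show ?thesis using norm_eq_exponent[of x] P_gt_1 powr_inj[of P] by simp
    qed
    have "?I = (\<integral>\<^sup>+x. ennreal_powr (?h n) r * indicator (padic_ball a l) x \<partial>M)"
      by (intro nn_integral_cong) (auto split: split_indicator dest: const)
    also have "\<dots> = ennreal (P powr l) * ennreal_powr (?h n) r"
      by (subst nn_integral_cmult_indicator) (simp_all only: ball_sets emeasure_ball mult.commute)
    also have "\<dots> = ennreal (P powr (l - n)) * (ennreal (P powr n) * ennreal_powr (?h n) r)"
      using P_gt_1 by (simp add: mult.assoc[symmetric] ennreal_mult'[symmetric] flip: powr_add)
    also have "\<dots> \<le> ennreal (P powr (l - n)) * ennreal (N powr r * P powr (n * (1 - r / q)))"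
      by (intro mult_left_mono order_trans[OF member_le_morrey_sum le]) auto
    also have "\<dots> = ennreal (N powr r * P powr ((l - n) + n * (1 - r / q)))"
      by (simp add: ennreal_mult'[symmetric] powr_add mult_ac)
    also have "\<dots> \<le> ennreal (N powr r * P powr (l * (1 - r / q)))"
    proof (intro ennreal_leI mult_left_mono powr_mono)
      have "l * (r / q) \<le> n * (r / q)" using ln r by (intro mult_right_mono) auto
      thus "real_of_int (l - n) + n * (1 - r / q) \<le> l * (1 - r / q)" by (simp add: right_diff_distrib)
    qed (use P_gt_1 in auto)
    finally show ?thesis .
  qed
  thus "ennreal (P powr (l * (1 / q - 1 / r))) * ennreal_powr ?I (1 / r) \<le> ennreal N"
    using r N by (simp add: ball_0_term_le_iff)
qed

end

context padic_haar
begin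

section \<open>The operator\<close>

lemma sigma_finite_haar: "sigma_finite_measure M"
proof
  have "\<exists>n. x \<in> padic_ball 0 (int n)" for x :: "'p padic"
    by (cases "x = 0") (auto simp: in_ball_0_iff intro: exI[of _ "nat (padic_exponent x)"])
  hence "\<Union> (range (\<lambda>n. padic_ball (0 :: 'p padic) (int n))) = space M" by auto
  moreover have "countable (range (\<lambda>n. padic_ball (0 :: 'p padic) (int n)))" by simp
  moreover have "range (\<lambda>n. padic_ball (0 :: 'p padic) (int n)) \<subseteq> sets M"
    by (intro image_subsetI ball_sets)
  moreover have "\<forall>a\<in>range (\<lambda>n. padic_ball (0 :: 'p padic) (int n)). emeasure M a \<noteq> \<infinity>"
    by (simp add: emeasure_ball)
  ultimately show "\<exists>A. countable A \<and> A \<subseteq> sets M \<and> \<Union> A = space M \<and> (\<forall>a\<in>A. emeasure M a \<noteq> \<infinity>)"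
    by blast
qed

lemma punctured_sets: "- {0} \<in> sets M"
  using sets.compl_sets[OF singleton_sets[of 0]] by (simp only: Compl_eq_Diff_UNIV space_M)

lemma norm_ennreal_measurable:
  assumes [measurable]: "f \<in> borel_measurable M"
  shows "(\<lambda>x. ennreal (norm (f x :: complex))) \<in> borel_measurable M"
  by measurable

lemma D_kernel_measurable: "(\<lambda>t. D_kernel lam s t) \<in> borel_measurable M"
  unfolding D_kernel_def by measurable

lemma D_operator_measurable:
  assumes f: "f \<in> borel_measurable M"
  shows "D_operator M lam f \<in> borel_measurable M"
proof -
  interpret sigma_finite_measure M by (rule sigma_finite_haar)
  have [measurable]: "(\<lambda>x. padic_norm (fst x)) \<in> borel_measurable (M \<Otimes>\<^sub>M M)"
    "(\<lambda>x. padic_norm (snd x)) \<in> borel_measurable (M \<Otimes>\<^sub>M M)"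
    "(\<lambda>x. f (snd x)) \<in> borel_measurable (M \<Otimes>\<^sub>M M)"
    using f norm_measurable by (auto intro: measurable_compose[OF measurable_fst] measurable_compose[OF measurable_snd])
  have ind: "(\<lambda>x. indicat_real (- {0}) (snd x)) \<in> borel_measurable (M \<Otimes>\<^sub>M M)"
    by (rule measurable_compose[OF measurable_snd borel_measurable_indicator[OF punctured_sets]])
  have ker: "(\<lambda>x. complex_of_real (D_kernel lam (fst x) (snd x)) * f (snd x)) \<in> borel_measurable (M \<Otimes>\<^sub>M M)"
    unfolding D_kernel_def by measurable
  show ?thesis
    unfolding D_operator_def[abs_def] set_lebesgue_integral_def
    using borel_measurable_scaleR[OF ind ker]
    by (intro borel_measurable_lebesgue_integral) (simp add: case_prod_beta')
qed

lemma D_kernel_0 [simp]: "D_kernel lam 0 t = 0" "D_kernel lam s 0 = 0"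
  by (simp_all add: D_kernel_def)

lemma D_kernel_nonneg: "0 \<le> D_kernel lam s t"
  by (simp add: D_kernel_def)

text \<open>The kernel is homogeneous of degree \<open>- 1\<close>, hence determined by the ratio of the two norms.\<close>

lemma D_kernel_eq_dilation_kernel:
  assumes s: "s \<in> padic_sphere m" and t: "t \<in> padic_sphere j"
  shows "D_kernel lam s (t :: 'p padic) = P powr (- real_of_int m) * dilation_kernel lam (P powr (j - m))"
proof -
  have st: "padic_norm s = P powr m" "padic_norm t = P powr j"
    using s t by (auto simp: padic_sphere_def norm_eq_exponent)
  have max: "max (P powr m) (P powr j) = P powr m * max 1 (P powr (j - m))"
    using P_gt_1 by (subst max_mult_distrib_left) (auto simp flip: powr_add)
  have "D_kernel lam s t
      = (P powr m * P powr j) powr (lam / 2) / ((P powr m) powr (lam + 1) * max 1 (P powr (j - m)) powr (lam + 1))"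
    unfolding D_kernel_def st max by (simp add: powr_mult)
  also have "(P powr m * P powr j) powr (lam / 2)
      = P powr (- real_of_int m) * (P powr m) powr (lam + 1) * (P powr (j - m)) powr (lam / 2)"
    unfolding powr_powr powr_add[symmetric]
    by (rule arg_cong[where f = "\<lambda>x. P powr x"]) (simp add: field_simps)
  finally show ?thesis
    using P_gt_1 by (simp add: dilation_kernel_def)
qed

lemma nn_integral_D_kernel:
  assumes [measurable]: "f \<in> borel_measurable M" and s: "s \<in> padic_sphere m"
  shows "(\<integral>\<^sup>+t. ennreal (D_kernel lam s t * norm (f t)) \<partial>M)
     = ennreal (P powr (- real_of_int m)) * int_sum (\<lambda>i. ennreal (dilation_kernel lam (P powr i)) * sphere_mass f (m + i))"
proof -
  let ?k = "\<lambda>i::int. dilation_kernel lam (P powr i)"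
  note [measurable] = D_kernel_measurable
  have u: "(\<lambda>t. ennreal (D_kernel lam s t * norm (f t))) \<in> borel_measurable M"
    by measurable
  have sph: "(\<integral>\<^sup>+t\<in>padic_sphere j. ennreal (D_kernel lam s t * norm (f t)) \<partial>M)
      = ennreal (P powr (- real_of_int m)) * (ennreal (?k (j - m)) * sphere_mass f j)" for j
  proof -
    have "(\<integral>\<^sup>+t\<in>padic_sphere j. ennreal (D_kernel lam s t * norm (f t)) \<partial>M)
       = (\<integral>\<^sup>+t. ennreal (P powr (- real_of_int m) * ?k (j - m)) * (ennreal (norm (f t)) * indicator (padic_sphere j) t) \<partial>M)"
      by (intro nn_integral_cong)
         (auto simp: D_kernel_eq_dilation_kernel[OF s] ennreal_mult' dilation_kernel_nonneg split: split_indicator)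
    also have "\<dots> = ennreal (P powr (- real_of_int m) * ?k (j - m)) * sphere_mass f j"
      unfolding sphere_mass_def by (rule nn_integral_cmult) measurable
    finally show ?thesis by (simp add: ennreal_mult' mult.assoc)
  qed
  have "(\<integral>\<^sup>+t. ennreal (D_kernel lam s t * norm (f t)) \<partial>M)
     = int_sum (\<lambda>j. ennreal (P powr (- real_of_int m)) * (ennreal (?k (j - m)) * sphere_mass f j))"
    unfolding sph[symmetric] by (rule nn_integral_spheres[OF u]) simp
  also have "\<dots> = ennreal (P powr (- real_of_int m)) * int_sum (\<lambda>j. ennreal (?k (j - m)) * sphere_mass f j)"
    by (rule nn_integral_cmult) simp
  also have "int_sum (\<lambda>j. ennreal (?k (j - m)) * sphere_mass f j)
     = int_sum (\<lambda>i. ennreal (?k i) * sphere_mass f (m + i))"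
    by (subst int_sum_shift[symmetric, of _ m]) (simp add: add.commute)
  finally show ?thesis .
qed

text \<open>No integrability is assumed: where the integrand is not integrable, the Bochner integral is \<open>0\<close>.\<close>

lemma norm_D_operator_le:
  "ennreal (norm (D_operator M lam f s)) \<le> (\<integral>\<^sup>+t. ennreal (D_kernel lam s t * norm (f t)) \<partial>M)"
proof (cases "set_integrable M (- {0}) (\<lambda>t. of_real (D_kernel lam s t) * f t)")
  case True
  have "ennreal (norm (D_operator M lam f s))
     \<le> (\<integral>\<^sup>+t. ennreal (norm (indicat_real (- {0}) t *\<^sub>R (of_real (D_kernel lam s t) * f t))) \<partial>M)"
    unfolding D_operator_def set_lebesgue_integral_def
    by (rule integral_norm_bound_ennreal) (use True in \<open>simp add: set_integrable_def\<close>)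
  also have "\<dots> \<le> (\<integral>\<^sup>+t. ennreal (D_kernel lam s t * norm (f t)) \<partial>M)"
    by (intro nn_integral_mono) (auto simp: norm_mult D_kernel_nonneg split: split_indicator)
  finally show ?thesis .
next
  case False
  thus ?thesis
    by (simp add: D_operator_def set_lebesgue_integral_def set_integrable_def not_integrable_integral_eq)
qed

text \<open>The kernel vanishes at \<open>s = 0\<close>, since \<open>0 powr a = 0\<close> even for \<open>a = 0\<close>.\<close>

lemma D_operator_0: "D_operator M lam f 0 = 0"
  by (simp add: D_operator_def set_lebesgue_integral_def)

lemma sum_sphere_mass_le:
  assumes [measurable]: "f \<in> borel_measurable M"
  shows "int_sum (\<lambda>j. sphere_mass f j * indicator {..l} j) \<le> ball_mass f l"
proof -
  let ?u = "\<lambda>t. ennreal (norm (f t)) * indicator (padic_ball 0 l - {0}) t"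
  have "int_sum (\<lambda>j. sphere_mass f j * indicator {..l} j) = int_sum (\<lambda>j. \<integral>\<^sup>+t\<in>padic_sphere j. ?u t \<partial>M)"
  proof (intro nn_integral_cong)
    fix j
    have "sphere_mass f j * indicator {..l} j
        = (\<integral>\<^sup>+t. ennreal (norm (f t)) * indicator (padic_sphere j) t * indicator {..l} j \<partial>M)"
      unfolding sphere_mass_def by (rule nn_integral_multc[symmetric]) measurable
    also have "\<dots> = (\<integral>\<^sup>+t\<in>padic_sphere j. ?u t \<partial>M)"
      by (intro nn_integral_cong) (auto simp: padic_sphere_def in_ball_0_iff split: split_indicator)
    finally show "sphere_mass f j * indicator {..l} j = (\<integral>\<^sup>+t\<in>padic_sphere j. ?u t \<partial>M)" .
  qed
  also have "\<dots> = (\<integral>\<^sup>+t. ?u t \<partial>M)"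
    by (rule nn_integral_spheres[symmetric])
       (intro borel_measurable_times_ennreal norm_ennreal_measurable borel_measurable_indicator
          sets.Diff ball_sets singleton_sets assms, simp)
  also have "\<dots> \<le> ball_mass f l"
    unfolding ball_mass_def by (intro nn_integral_mono) (auto split: split_indicator)
  finally show ?thesis .
qed

lemma sphere_mass_le_mass: "sphere_mass f n \<le> ball_mass f n"
  unfolding sphere_mass_def ball_mass_def
  by (intro nn_integral_mono) (auto simp: padic_sphere_def in_ball_0_iff split: split_indicator)

text \<open>On the sphere of radius \<open>P powr m\<close> the image is at most \<open>P powr (- m)\<close> times a sum of sphere masses
of \<open>f\<close>, and the sphere has measure at most \<open>P powr m\<close>; so these two factors cancel. Summing over
\<open>m \<le> n\<close> with the ratio index \<open>i\<close> fixed collects the spheres of the ball of radius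
\<open>P powr (n + i)\<close>.\<close>

lemma ball_mass_D_operator_le:
  assumes f [measurable]: "f \<in> borel_measurable M"
  shows "ball_mass (D_operator M lam f) n
     \<le> int_sum (\<lambda>i. ennreal (dilation_kernel lam (P powr i)) * ball_mass f (n + i))"
proof -
  let ?k = "\<lambda>i::int. ennreal (dilation_kernel lam (P powr i))" and ?g = "D_operator M lam f"
  define T where "T m = int_sum (\<lambda>i. ?k i * sphere_mass f (m + i))" for m
  note [measurable] = D_operator_measurable[OF f]
  have sph: "(\<integral>\<^sup>+s\<in>padic_sphere m. (ennreal (norm (?g s)) * indicator (padic_ball 0 n) s) \<partial>M)
      \<le> T m * indicator {..n} m" for m
  proof -
    have "(\<integral>\<^sup>+s\<in>padic_sphere m. (ennreal (norm (?g s)) * indicator (padic_ball 0 n) s) \<partial>M)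
       \<le> (\<integral>\<^sup>+s\<in>padic_sphere m. (ennreal (P powr (- real_of_int m)) * T m * indicator {..n} m) \<partial>M)"
    proof (intro nn_integral_mono)
      fix s :: "'p padic"
      show "ennreal (norm (?g s)) * indicator (padic_ball 0 n) s * indicator (padic_sphere m) s
         \<le> ennreal (P powr (- real_of_int m)) * T m * indicator {..n} m * indicator (padic_sphere m) s"
      proof (cases "s \<in> padic_sphere m")
        case True
        have "ennreal (norm (?g s)) \<le> ennreal (P powr (- real_of_int m)) * T m"
          using norm_D_operator_le[of lam f s] unfolding nn_integral_D_kernel[OF f True] T_def .
        moreover have "indicator (padic_ball 0 n) s = (indicator {..n} m :: ennreal)"
          using True by (auto simp: padic_sphere_def in_ball_0_iff split: split_indicator)
        ultimately show ?thesis by (simp add: mult_right_mono)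
      qed simp
    qed
    also have "\<dots> = (ennreal (P powr (- real_of_int m)) * T m * indicator {..n} m) * ennreal ((1 - 1 / P) * P powr m)"
      by (rule nn_integral_sphere_const) (rule refl)
    also have "\<dots> = ennreal (P powr (- real_of_int m)) * ennreal ((1 - 1 / P) * P powr m) * (T m * indicator {..n} m)"
      by (simp only: mult_ac)
    also have "\<dots> \<le> 1 * (T m * indicator {..n} m)"
    proof (rule mult_right_mono)
      have "P powr (- real_of_int m) * ((1 - 1 / P) * P powr m) \<le> 1"
      proof -
        have "P powr (- real_of_int m) * P powr m = 1"
          using P_gt_1 by (simp only: powr_add[symmetric]) simp
        hence eq: "P powr (- real_of_int m) * ((1 - 1 / P) * P powr m) = 1 - 1 / P"
          by (simp only: mult.left_commute mult_1_right)
        show ?thesis unfolding eq using P_gt_1 by simp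
      qed
      thus "ennreal (P powr (- real_of_int m)) * ennreal ((1 - 1 / P) * P powr m) \<le> 1"
        by (simp add: ennreal_mult'[symmetric] flip: ennreal_1)
    qed simp
    finally show ?thesis by simp
  qed
  have "ball_mass ?g n = int_sum (\<lambda>m. \<integral>\<^sup>+s\<in>padic_sphere m. (ennreal (norm (?g s)) * indicator (padic_ball 0 n) s) \<partial>M)"
    unfolding ball_mass_def by (rule nn_integral_spheres)
      (intro borel_measurable_times_ennreal norm_ennreal_measurable borel_measurable_indicator
          ball_sets D_operator_measurable[OF f], simp add: D_operator_0)
  also have "\<dots> \<le> int_sum (\<lambda>m. T m * indicator {..n} m)"
    by (intro nn_integral_mono sph)
  also have "\<dots> = int_sum (\<lambda>m. int_sum (\<lambda>i. ?k i * (sphere_mass f (m + i) * indicator {..n} m)))"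
  proof (intro nn_integral_cong)
    fix m
    have "T m * indicator {..n} m = int_sum (\<lambda>i. ?k i * sphere_mass f (m + i) * indicator {..n} m)"
      unfolding T_def by (rule nn_integral_multc[symmetric]) simp
    thus "T m * indicator {..n} m = int_sum (\<lambda>i. ?k i * (sphere_mass f (m + i) * indicator {..n} m))"
      by (simp only: mult.assoc)
  qed
  also have "\<dots> = int_sum (\<lambda>i. ?k i * int_sum (\<lambda>m. sphere_mass f (m + i) * indicator {..n} m))"
    by (subst int_sum_swap) (simp add: nn_integral_cmult)
  also have "\<dots> \<le> int_sum (\<lambda>i. ?k i * ball_mass f (n + i))"
  proof (intro nn_integral_mono mult_left_mono)
    fix i
    have "int_sum (\<lambda>m. sphere_mass f (m + i) * indicator {..n} m)
       = int_sum (\<lambda>m. sphere_mass f (m + i) * indicator {..n + i} (m + i))"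
      by (intro nn_integral_cong) (auto split: split_indicator)
    also have "\<dots> = int_sum (\<lambda>j. sphere_mass f j * indicator {..n + i} j)"
      by (rule int_sum_shift)
    also have "\<dots> \<le> ball_mass f (n + i)" by (rule sum_sphere_mass_le[OF f])
    finally show "int_sum (\<lambda>m. sphere_mass f (m + i) * indicator {..n} m) \<le> ball_mass f (n + i)" .
  qed simp
  finally show ?thesis .
qed

text \<open>The convolution that dominates the Cesaro means of the image of \<open>f\<close>. Its finiteness also yields the
convergence of the integral that defines the operator.\<close>

definition cesaro_majorant :: "real \<Rightarrow> real \<Rightarrow> ('p padic \<Rightarrow> complex) \<Rightarrow> int \<Rightarrow> ennreal" where
  "cesaro_majorant \<beta> lam f n =
     int_sum (\<lambda>i. ennreal (dilation_kernel lam (P powr i) * P powr (real_of_int i * (1 - \<beta>))) * cesaro_mean \<beta> f (n + i))"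

lemma cesaro_majorant_eq:
  "cesaro_majorant \<beta> lam f n = ennreal (P powr (real_of_int n * (\<beta> - 1))) *
     int_sum (\<lambda>i. ennreal (dilation_kernel lam (P powr i)) * ball_mass f (n + i))"
proof -
  have "ennreal (dilation_kernel lam (P powr i) * P powr (real_of_int i * (1 - \<beta>))) * cesaro_mean \<beta> f (n + i)
     = ennreal (P powr (real_of_int n * (\<beta> - 1))) * (ennreal (dilation_kernel lam (P powr i)) * ball_mass f (n + i))" for i
  proof -
    have e: "P powr (real_of_int i * (1 - \<beta>)) * P powr (real_of_int (n + i) * (\<beta> - 1)) = P powr (real_of_int n * (\<beta> - 1))"
      unfolding powr_add[symmetric]
      by (rule arg_cong[where f = "\<lambda>x. P powr x"]) (simp add: algebra_simps)
    have "ennreal (dilation_kernel lam (P powr i) * P powr (real_of_int i * (1 - \<beta>))) * cesaro_mean \<beta> f (n + i)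
       = ennreal (dilation_kernel lam (P powr i)) *
           (ennreal (P powr (real_of_int i * (1 - \<beta>))) * ennreal (P powr (real_of_int (n + i) * (\<beta> - 1)))) * ball_mass f (n + i)"
      by (simp add: cesaro_mean_def ennreal_mult dilation_kernel_nonneg mult.assoc)
    also have "ennreal (P powr (real_of_int i * (1 - \<beta>))) * ennreal (P powr (real_of_int (n + i) * (\<beta> - 1))) = ennreal (P powr (real_of_int n * (\<beta> - 1)))"
      by (simp only: ennreal_mult[symmetric] powr_ge_zero e)
    finally show ?thesis by (simp only: mult_ac)
  qed
  thus ?thesis unfolding cesaro_majorant_def by (simp add: nn_integral_cmult)
qed

lemma cesaro_mean_D_operator_le:
  assumes "f \<in> borel_measurable M"
  shows "cesaro_mean \<beta> (D_operator M lam f) n \<le> cesaro_majorant \<beta> lam f n"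
  unfolding cesaro_majorant_eq cesaro_mean_def
  by (intro mult_left_mono ball_mass_D_operator_le[OF assms]) simp

lemma ball_mass_finite_of_cesaro_mean_finite:
  assumes "cesaro_mean \<beta> f n < top"
  shows "ball_mass f n < top"
  using assms P_gt_1 unfolding cesaro_mean_def by (auto simp: ennreal_mult_less_top)

text \<open>For \<open>s\<close> on the sphere of exponent \<open>m\<close>, the absolute integral is a multiple of a sum of sphere masses,
which the corresponding sum of ball masses, a multiple of the majorant at \<open>m\<close>, dominates.\<close>

lemma D_kernel_set_integrable:
  assumes f [measurable]: "f \<in> borel_measurable M" and s: "s \<noteq> 0"
    and fin: "cesaro_majorant \<beta> lam f (padic_exponent s) < top"
  shows "set_integrable M (- {0}) (\<lambda>t. of_real (D_kernel lam s t) * f t)"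
proof -
  let ?m = "padic_exponent s" and ?k = "\<lambda>i::int. ennreal (dilation_kernel lam (P powr i))"
  have sm: "s \<in> padic_sphere ?m" using s by (simp add: padic_sphere_def)
  have "int_sum (\<lambda>i. ?k i * sphere_mass f (?m + i)) \<le> int_sum (\<lambda>i. ?k i * ball_mass f (?m + i))"
    by (intro nn_integral_mono mult_left_mono sphere_mass_le_mass) simp
  also have "\<dots> < top"
    using fin P_gt_1 unfolding cesaro_majorant_eq by (auto simp: ennreal_mult_less_top)
  finally have "(\<integral>\<^sup>+t. ennreal (D_kernel lam s t * norm (f t)) \<partial>M) < top"
    unfolding nn_integral_D_kernel[OF f sm] by (auto simp: ennreal_mult_less_top)
  moreover have "(\<integral>\<^sup>+t. ennreal (norm (indicat_real (- {0}) t *\<^sub>R (of_real (D_kernel lam s t) * f t))) \<partial>M)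
      \<le> (\<integral>\<^sup>+t. ennreal (D_kernel lam s t * norm (f t)) \<partial>M)"
    by (intro nn_integral_mono) (auto simp: norm_mult D_kernel_nonneg split: split_indicator)
  ultimately have fin: "(\<integral>\<^sup>+t. ennreal (norm (indicat_real (- {0}) t *\<^sub>R (of_real (D_kernel lam s t) * f t))) \<partial>M) < \<infinity>"
    by (simp add: le_less_trans)
  note [measurable] = D_kernel_measurable
  have "(\<lambda>t. complex_of_real (D_kernel lam s t)) \<in> borel_measurable M" by measurable
  thus ?thesis
    unfolding set_integrable_def
    by (intro integrableI_bounded[OF _ fin] borel_measurable_scaleR borel_measurable_times
        borel_measurable_indicator punctured_sets f)
qed

text \<open>Compact sets are bounded, hence contained in a ball about the origin.\<close>

lemma locally_integrableI:
  assumes g [measurable]: "g \<in> borel_measurable M" and fin: "\<And>n. ball_mass g n < top"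
  shows "locally_integrable M g"
  unfolding locally_integrable_def
proof (intro conjI allI impI)
  fix K :: "'p padic set" assume K: "compact K"
  obtain e where e: "\<And>x. x \<in> K \<Longrightarrow> padic_norm x \<le> e"
    using compact_imp_bounded[OF K] unfolding bounded_any_center[of K 0] padic_norm_eq_dist
    by (auto simp: dist_commute)
  obtain n where n: "e < P ^ n" using real_arch_pow[OF P_gt_1] by blast
  have KB: "K \<subseteq> padic_ball 0 (int n)"
    using e n P_gt_1 by (force simp: padic_ball_eq powr_realpow)
  have "K \<in> sets M" using compact_imp_closed[OF K] by simp
  moreover have "(\<integral>\<^sup>+x. ennreal (norm (indicat_real K x *\<^sub>R g x)) \<partial>M) \<le> ball_mass g (int n)"
    unfolding ball_mass_def using KB by (intro nn_integral_mono) (auto split: split_indicator)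
  hence "(\<integral>\<^sup>+x. ennreal (norm (indicat_real K x *\<^sub>R g x)) \<partial>M) < \<infinity>"
    using fin[of "int n"] by simp
  ultimately show "set_integrable M K g"
    unfolding set_integrable_def
    by (intro integrableI_bounded borel_measurable_scaleR borel_measurable_indicator g)
qed (rule g)

lemma cesaro_majorant_morrey_sum_le:
  assumes r: "1 \<le> r" and q: "0 < q"
    and W: "int_sum (\<lambda>i. ennreal (dilation_kernel lam (P powr i) * P powr (real_of_int i * (1 - \<beta>)) * P powr (- real_of_int i / q)))
      = ennreal W" "0 < W"
    and N: "cesaro_morrey_norm M \<beta> r q f = ennreal N" "0 \<le> N"
  shows "morrey_sum P r (cesaro_majorant \<beta> lam f) l
     \<le> ennreal ((2 powr (1 / r) * W * N) powr r * P powr (l * (1 - r / q)))"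
proof -
  have "morrey_sum P r (cesaro_majorant \<beta> lam f) l \<le> ennreal (W powr r * (2 * N powr r) * P powr (l * (1 - r / q)))"
    unfolding cesaro_majorant_def
  proof (rule morrey_sum_convolution_le[OF P_gt_1 r q _ W])
    show "morrey_sum P r (cesaro_mean \<beta> f) l \<le> ennreal (2 * N powr r * P powr (l * (1 - r / q)))" for l
      by (rule morrey_sum_le_of_cesaro_morrey_norm_le) (use r N in auto)
  qed (auto simp: dilation_kernel_nonneg)
  also have "W powr r * (2 * N powr r) = (2 powr (1 / r) * W * N) powr r"
    using r W(2) N(2) by (simp add: powr_mult powr_powr)
  finally show ?thesis .
qed

end

theorem theorem17:
  fixes M :: "'p :: prime_card padic measure" and r q \<beta> lam :: real
  assumes "normalized_haar M"
    and "1 \<le> r" and "r \<le> q"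
    and "0 \<le> \<beta>" and "\<beta> < 1"
    and "0 \<le> lam"
    and "lam / 2 + 1 > \<beta> + 1 / q"
  shows "(\<forall>f \<in> cesaro_morrey_space M \<beta> r q. \<forall>s. s \<noteq> 0 \<longrightarrow>
            set_integrable M (- {0}) (\<lambda>t. of_real (D_kernel lam s t) * f t)) \<and>
         (\<forall>f \<in> cesaro_morrey_space M \<beta> r q. D_operator M lam f \<in> cesaro_morrey_space M \<beta> r q) \<and>
         (\<exists>C>0. \<forall>f \<in> cesaro_morrey_space M \<beta> r q.
            cesaro_morrey_norm M \<beta> r q (D_operator M lam f)
              \<le> ennreal C * cesaro_morrey_norm M \<beta> r q f)"
proof -
  define P where "P = real CARD('p)"
  interpret padic_haar M P by (rule padic_haar.intro[OF assms(1) P_def])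
  have q: "0 < q" using assms(2,3) by linarith
  obtain W where W: "0 < W"
    "int_sum (\<lambda>i. ennreal (dilation_kernel lam (P powr i) * P powr (real_of_int i * (1 - \<beta>)) * P powr (- real_of_int i / q))) = ennreal W"
    by (rule dilation_kernel_summable[OF P_gt_1 q assms(4,6,7)])
  define C where "C = 2 powr (1 / r) * W"
  have C: "0 < C" using W by (simp add: C_def)
  have main: "(\<forall>s. s \<noteq> 0 \<longrightarrow> set_integrable M (- {0}) (\<lambda>t. of_real (D_kernel lam s t) * f t)) \<and>
      D_operator M lam f \<in> cesaro_morrey_space M \<beta> r q \<and>
      cesaro_morrey_norm M \<beta> r q (D_operator M lam f) \<le> ennreal C * cesaro_morrey_norm M \<beta> r q f"
    if "f \<in> cesaro_morrey_space M \<beta> r q" for f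
  proof -
    have f: "f \<in> borel_measurable M" and fin: "cesaro_morrey_norm M \<beta> r q f < top"
      using that by (auto simp: cesaro_morrey_space_def locally_integrable_def)
    then obtain N where N: "cesaro_morrey_norm M \<beta> r q f = ennreal N" "0 \<le> N"
      by (cases "cesaro_morrey_norm M \<beta> r q f") auto
    have maj: "morrey_sum P r (cesaro_majorant \<beta> lam f) l \<le> ennreal ((C * N) powr r * P powr (l * (1 - r / q)))" for l
      unfolding C_def by (rule cesaro_majorant_morrey_sum_le[OF assms(2) q W(2,1) N])
    have maj_fin: "cesaro_majorant \<beta> lam f n < top" for n
      by (rule finite_of_morrey_sum_finite[OF _ le_less_trans[OF maj]]) (use P_gt_1 in auto)
    have "cesaro_morrey_norm M \<beta> r q (D_operator M lam f) \<le> ennreal (C * N)"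
    proof (rule cesaro_morrey_norm_le_of_morrey_sum_le[OF assms(2) q])
      show "morrey_sum P r (cesaro_mean \<beta> (D_operator M lam f)) l
         \<le> ennreal ((C * N) powr r * P powr (l * (1 - r / q)))" for l
        using assms(2)
        by (intro order_trans[OF morrey_sum_mono maj] cesaro_mean_D_operator_le f) auto
    qed (use C N in simp)
    hence bound: "cesaro_morrey_norm M \<beta> r q (D_operator M lam f) \<le> ennreal C * cesaro_morrey_norm M \<beta> r q f"
      using C N by (simp add: ennreal_mult)
    have "ball_mass (D_operator M lam f) n < top" for n
      by (rule ball_mass_finite_of_cesaro_mean_finite[OF le_less_trans[OF cesaro_mean_D_operator_le[OF f] maj_fin]])
    hence "locally_integrable M (D_operator M lam f)"
      by (rule locally_integrableI[OF D_operator_measurable[OF f]])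
    moreover have "cesaro_morrey_norm M \<beta> r q (D_operator M lam f) < top"
      by (rule le_less_trans[OF bound]) (use N in \<open>simp add: ennreal_mult_less_top\<close>)
    moreover have "set_integrable M (- {0}) (\<lambda>t. of_real (D_kernel lam s t) * f t)" if "s \<noteq> 0" for s
      by (rule D_kernel_set_integrable[OF f that maj_fin])
    ultimately show ?thesis using bound by (simp add: cesaro_morrey_space_def)
  qed
  show ?thesis using main C by blast
qed

end
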